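(* Let $m\ge1$, let $r\ge1$, and let $m_1,\ldots,m_m\ge2$ be integers. On $(\mathbb C^{m+1},0)$ with coordinates $(z,y_1,\ldots,y_m)$ and $D=\{z=0\}$, define a germ $f$ by $$f_z=z-z^{r+1}(1+y_1),\qquad f_{y_1}=y_1-y_1^{m_1}-z,\qquad f_{y_j}=y_j-y_j^{m_j}-y_{j-1}\quad(2\le j\le m).$$ Put $M=m_1\cdots m_m$. Then the origin is an isolated normally resonant fixed point, and $$A_{f,0}\simeq\mathbb C\{y_m\}/\bigl(y_m^{(r+1)M}\bigr).$$ In particular, $\operatorname{length}(A_{f,0})=(r+1)M$. The presentation of the fixed-point ideal obtained by removing the unit $1+y_1$ from the first fixed equation, namely $$\bigl(z^{r+1},\;y_1^{m_1}+z,\;y_2^{m_2}+y_1,\;\ldots,\;y_m^{m_m}+y_{m-1}\bigr),$$ is normally admissible, and the logarithmic de Rham index is $$\operatorname{Ind}^{\mathrm{dR},\log}_{0,D}(f)=rM.$$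
   Context: The fixed-point ideal is $I=(z-f_z,\,y_1-f_{y_1},\ldots,y_m-f_{y_m})\subset R=\mathbb C\{z,y_1,\ldots,y_m\}$ and $A_{f,0}=R/I$. Writing $f_z=z\,a$ with $a(0)\ne0$, the fixed point $0$ is normally resonant if $a(0)=1$. For $0\ne h=\sum_{\alpha\ge0}h_\alpha(y)z^\alpha\in R$, the normal order is $\nu_D(h)=\min\{\alpha:h_\alpha\ne0\}$ and the normal initial form is $\operatorname{in}_D(h)=h_{\nu_D(h)}(y)z^{\nu_D(h)}$. A regular sequence $q_0,\ldots,q_m$ generating $I$ is a normally admissible presentation if $R/(\operatorname{in}_D(q_0),\ldots,\operatorname{in}_D(q_m))$ has finite length and $\sum_j\nu_D(q_j)\ge1$ (the number of branches of $D$). $J_f^{\log}$ is the endomorphism of $\Omega^1(\log D)$ (frame $\mathrm dz/z,\mathrm dy_1,\ldots,\mathrm dy_m$) over the fixed-point scheme induced by pull-back of logarithmic forms, with $f^*(\mathrm dz/z)=\mathrm dz/z+\mathrm da/a$. The logarithmic de Rham index is the Grothendieck residue $$\operatorname{Ind}^{\mathrm{dR},\log}_{0,D}(f)=\operatorname{Res}_0\left[\frac{\det(1-J_f^{\log})\,\mathrm dz\wedge \mathrm dy_1\wedge\cdots\wedge \mathrm dy_m}{z-f_z,\,y_1-f_{y_1},\ldots,y_m-f_{y_m}}\right].$$ *)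

theory Defs
  imports
    "HOL-Analysis.Infinite_Sum"
    "HOL-Algebra.QuotRing"
    "HOL-Library.Multiset"
    "HOL-Library.Extended_Nat"
    "Jordan_Normal_Form.Determinant"
begin

section \<open>Power series in the variables \<open>x\<^sub>i\<close>, \<open>i :: nat\<close>\<close>

text \<open>
  A monomial is the multiset of its variables, with multiplicity: \<open>count A i\<close> is the exponent
  of \<open>x\<^sub>i\<close> in the monomial \<open>A\<close>, \<open>size A\<close> its total degree, and the product of monomials is the sum
  of multisets.  The type consists of all formal series; the rings
  \<open>\<complex>{x\<^sub>i | i \<in> V}\<close> are cut out of it below.
\<close>

typedef 'a mfps = "UNIV :: (nat multiset \<Rightarrow> 'a) set"
  morphisms mcoeff Abs_mfps ..

lemma mcoeff_Abs [simp]: "mcoeff (Abs_mfps f) = f"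
  by (simp add: Abs_mfps_inverse)

lemma mfps_eqI: "(\<And>A. mcoeff f A = mcoeff g A) \<Longrightarrow> f = g"
  by (metis mcoeff_inject ext)

lemma finite_submultisets [simp]: "finite {B. B \<subseteq># (A :: 'b multiset)}"
proof (induction A)
  case (add x A)
  have "{B. B \<subseteq># add_mset x A} \<subseteq> {B. B \<subseteq># A} \<union> add_mset x ` {B. B \<subseteq># A}"
  proof
    fix B assume "B \<in> {B. B \<subseteq># add_mset x A}"
    then have B: "B \<subseteq># add_mset x A" by simp
    show "B \<in> {B. B \<subseteq># A} \<union> add_mset x ` {B. B \<subseteq># A}"
    proof (cases "x \<in># B")
      case True
      then obtain C where "B = add_mset x C" by (metis mset_add)
      with B show ?thesis by auto
    next
      case False
      with B have "B \<subseteq># A"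
        by (metis add_mset_add_single diff_single_trivial subset_eq_diff_conv)
      then show ?thesis by simp
    qed
  qed
  with add.IH show ?case by (meson finite_UnI finite_imageI finite_subset)
qed simp

instantiation mfps :: (comm_ring_1) comm_ring_1
begin

definition "0 = Abs_mfps (\<lambda>A. 0)"
definition "1 = Abs_mfps (\<lambda>A. if A = {#} then 1 else 0)"
definition "f + g = Abs_mfps (\<lambda>A. mcoeff f A + mcoeff g A)"
definition "f - g = Abs_mfps (\<lambda>A. mcoeff f A - mcoeff g A)"
definition "- f = Abs_mfps (\<lambda>A. - mcoeff f A)"
definition "f * g = Abs_mfps (\<lambda>A. \<Sum>B | B \<subseteq># A. mcoeff f B * mcoeff g (A - B))"

lemmas mfps_simps =
  zero_mfps_def one_mfps_def plus_mfps_def minus_mfps_def uminus_mfps_def times_mfps_def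

instance
proof
  fix a b c :: "'a mfps"
  show "a * b * c = a * (b * c)"
  proof (rule mfps_eqI)
    fix A :: "nat multiset"
    have diff: "A - C - (B - C) = A - B" if "C \<subseteq># B" for B C :: "nat multiset"
      using that by (simp add: multiset_eq_iff subseteq_mset_def)
    have "mcoeff (a * b * c) A = (\<Sum>B | B \<subseteq># A. \<Sum>C | C \<subseteq># B.
        mcoeff a C * mcoeff b (B - C) * mcoeff c (A - B))"
      by (simp add: times_mfps_def sum_distrib_right)
    also have "\<dots> = (\<Sum>(B, C) \<in> (SIGMA B:{B. B \<subseteq># A}. {C. C \<subseteq># B}).
        mcoeff a C * mcoeff b (B - C) * mcoeff c (A - B))"
      by (rule sum.Sigma) auto
    also have "\<dots> = (\<Sum>(C, D) \<in> (SIGMA C:{C. C \<subseteq># A}. {D. D \<subseteq># A - C}).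
        mcoeff a C * (mcoeff b D * mcoeff c (A - C - D)))"
      by (rule sum.reindex_bij_witness[where i = "\<lambda>(C, D). (C + D, C)" and j = "\<lambda>(B, C). (C, B - C)"])
        (auto simp: diff mult.assoc subset_eq_diff_conv subset_mset.le_diff_conv2 add.commute
          intro: subset_mset.order_trans)
    also have "\<dots> = (\<Sum>C | C \<subseteq># A. \<Sum>D | D \<subseteq># A - C.
        mcoeff a C * (mcoeff b D * mcoeff c (A - C - D)))"
      by (rule sum.Sigma[symmetric]) auto
    also have "\<dots> = mcoeff (a * (b * c)) A"
      by (simp add: times_mfps_def sum_distrib_left)
    finally show "mcoeff (a * b * c) A = mcoeff (a * (b * c)) A" .
  qed
  show "a * b = b * a"
  proof (rule mfps_eqI)
    fix A :: "nat multiset"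
    have dd: "A - (A - B) = B" if "B \<subseteq># A" for B
      using that by (simp add: multiset_eq_iff subseteq_mset_def)
    have "(\<Sum>B | B \<subseteq># A. mcoeff a B * mcoeff b (A - B)) =
        (\<Sum>B | B \<subseteq># A. mcoeff b B * mcoeff a (A - B))"
      by (rule sum.reindex_bij_witness[where i = "\<lambda>B. A - B" and j = "\<lambda>B. A - B"])
        (auto simp: dd mult.commute)
    then show "mcoeff (a * b) A = mcoeff (b * a) A"
      by (simp add: times_mfps_def)
  qed
  show "1 * a = a"
  proof (rule mfps_eqI)
    fix A
    have "mcoeff (1 * a) A = (\<Sum>B | B \<subseteq># A. (if B = {#} then 1 else 0) * mcoeff a (A - B))"
      by (simp add: mfps_simps)
    also have "\<dots> = (\<Sum>B\<in>{{#}}. (if B = {#} then 1 else 0) * mcoeff a (A - B))"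
      by (rule sum.mono_neutral_right) auto
    finally show "mcoeff (1 * a) A = mcoeff a A" by simp
  qed
  show "(a + b) * c = a * c + b * c"
    by (simp add: mfps_simps distrib_right sum.distrib)
  have "mcoeff (0 :: 'a mfps) {#} \<noteq> mcoeff 1 {#}"
    by (simp add: mfps_simps)
  then show "(0 :: 'a mfps) \<noteq> 1" by metis
qed (simp_all add: mfps_simps mcoeff_inverse algebra_simps)

end

definition mvar :: "nat \<Rightarrow> 'a::comm_ring_1 mfps"
  where "mvar i = Abs_mfps (\<lambda>A. if A = {#i#} then 1 else 0)"

definition mconst :: "'a::comm_ring_1 \<Rightarrow> 'a mfps"
  where "mconst c = Abs_mfps (\<lambda>A. if A = {#} then c else 0)"

definition mderiv :: "nat \<Rightarrow> 'a::comm_ring_1 mfps \<Rightarrow> 'a mfps"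
  where "mderiv i f = Abs_mfps (\<lambda>A. of_nat (count A i + 1) * mcoeff f (add_mset i A))"

text \<open>
  Value at a point.  Only meaningful where the series converges absolutely.
\<close>

definition meval :: "complex mfps \<Rightarrow> (nat \<Rightarrow> complex) \<Rightarrow> complex"
  where "meval f x = (\<Sum>\<^sub>\<infinity>A. mcoeff f A * (\<Prod>i\<in>#A. x i))"


section \<open>The ring \<open>\<complex>{x\<^sub>i | i \<in> V}\<close> of convergent power series\<close>

text \<open>
  For finite \<open>V\<close>, a series converges on a neighbourhood of the origin iff it converges absolutely
  on some polydisc with all radii equal to a single \<open>\<rho> > 0\<close>.
\<close>

definition conv_series :: "nat set \<Rightarrow> complex mfps set"
  where "conv_series V = {f. (\<forall>A. mcoeff f A \<noteq> 0 \<longrightarrow> set_mset A \<subseteq> V) \<and>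
    (\<exists>\<rho>>0. (\<lambda>A. norm (mcoeff f A) * \<rho> ^ size A) summable_on UNIV)}"

definition conv_ring :: "nat set \<Rightarrow> complex mfps ring"
  where "conv_ring V =
    \<lparr>carrier = conv_series V, mult = (*), one = 1, zero = 0, add = (+)\<rparr>"

text \<open>
  The length of a ring as a module over itself.  For \<open>A = R Quot I\<close> this is also the length
  of \<open>A\<close> as an \<open>R\<close>-module.
\<close>

definition ring_length :: "('a, 'b) ring_scheme \<Rightarrow> enat"
  where "ring_length A = (SUP n \<in> {n. \<exists>C. (\<forall>i\<le>n. ideal (C i) A) \<and> (\<forall>i<n. C i \<subset> C (Suc i))}. enat n)"

text \<open>The sequence \<open>q 0, \<dots>, q m\<close>.\<close>

definition regular_sequence :: "('a, 'b) ring_scheme \<Rightarrow> nat \<Rightarrow> (nat \<Rightarrow> 'a) \<Rightarrow> bool"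
  where "regular_sequence R m q \<longleftrightarrow>
    (\<forall>i\<le>m. q i \<in> carrier R) \<and>
    Idl\<^bsub>R\<^esub> (q ` {..m}) \<noteq> carrier R \<and>
    (\<forall>i\<le>m. \<forall>h\<in>carrier R. q i \<otimes>\<^bsub>R\<^esub> h \<in> Idl\<^bsub>R\<^esub> (q ` {..<i}) \<longrightarrow> h \<in> Idl\<^bsub>R\<^esub> (q ` {..<i}))"


section \<open>Germs of self-maps of \<open>(\<complex>\<^bsup>m+1\<^esup>, 0)\<close>\<close>

text \<open>
  The coordinates are \<open>z = x\<^sub>0\<close> and \<open>y\<^sub>j = x\<^sub>j\<close> for \<open>1 \<le> j \<le> m\<close>; the divisor \<open>D\<close> is \<open>{z = 0}\<close>.
  A germ is given by its components \<open>f 0, \<dots>, f m\<close>; further values of \<open>f\<close> are ignored.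
\<close>

abbreviation germ_ring :: "nat \<Rightarrow> complex mfps ring"
  where "germ_ring m \<equiv> conv_ring {..m}"

definition fixed_ideal :: "nat \<Rightarrow> (nat \<Rightarrow> complex mfps) \<Rightarrow> complex mfps set"
  where "fixed_ideal m f = Idl\<^bsub>germ_ring m\<^esub> ((\<lambda>i. mvar i - f i) ` {..m})"

definition fixed_algebra :: "nat \<Rightarrow> (nat \<Rightarrow> complex mfps) \<Rightarrow> complex mfps set ring"
  where "fixed_algebra m f = germ_ring m Quot fixed_ideal m f"

definition isolated_fixed_point :: "nat \<Rightarrow> (nat \<Rightarrow> complex mfps) \<Rightarrow> bool"
  where "isolated_fixed_point m f \<longleftrightarrow>
    (\<forall>i\<le>m. f i \<in> carrier (germ_ring m) \<and> meval (f i) (\<lambda>_. 0) = 0) \<and>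
    (\<exists>\<epsilon>>0. \<forall>x. (\<forall>i\<le>m. norm (x i) < \<epsilon>) \<and> (\<forall>i\<le>m. meval (f i) x = x i) \<longrightarrow> (\<forall>i\<le>m. x i = 0))"

text \<open>The germ \<open>a\<close> with \<open>f\<^sub>z = z a\<close>, unique since \<open>z\<close> is not a zero divisor.\<close>

definition normal_factor :: "nat \<Rightarrow> (nat \<Rightarrow> complex mfps) \<Rightarrow> complex mfps"
  where "normal_factor m f = (THE a. a \<in> carrier (germ_ring m) \<and> f 0 = mvar 0 * a)"

definition normally_resonant :: "nat \<Rightarrow> (nat \<Rightarrow> complex mfps) \<Rightarrow> bool"
  where "normally_resonant m f \<longleftrightarrow>
    (\<exists>a\<in>carrier (germ_ring m). f 0 = mvar 0 * a \<and> meval a (\<lambda>_. 0) = 1)"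

text \<open>Normal order and normal initial form, for nonzero \<open>h\<close>.\<close>

definition normal_order :: "'a::comm_ring_1 mfps \<Rightarrow> nat"
  where "normal_order h = (LEAST k. \<exists>A. count A 0 = k \<and> mcoeff h A \<noteq> 0)"

definition normal_initial :: "'a::comm_ring_1 mfps \<Rightarrow> 'a mfps"
  where "normal_initial h =
    Abs_mfps (\<lambda>A. if count A 0 = normal_order h then mcoeff h A else 0)"

text \<open>The lower bound on the sum is the number of branches of \<open>D\<close>, here one.\<close>

definition normally_admissible ::
    "nat \<Rightarrow> (nat \<Rightarrow> complex mfps) \<Rightarrow> (nat \<Rightarrow> complex mfps) \<Rightarrow> bool"
  where "normally_admissible m f q \<longleftrightarrow>
    regular_sequence (germ_ring m) m q \<and>
    Idl\<^bsub>germ_ring m\<^esub> (q ` {..m}) = fixed_ideal m f \<and>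
    ring_length (germ_ring m Quot Idl\<^bsub>germ_ring m\<^esub> ((\<lambda>j. normal_initial (q j)) ` {..m})) < \<infinity> \<and>
    (\<Sum>j\<le>m. normal_order (q j)) \<ge> 1"


section \<open>The logarithmic de Rham index\<close>

text \<open>
  The Grothendieck residue of \<open>h dx\<^sub>0 \<and> \<dots> \<and> dx\<^sub>m\<close> with denominators \<open>g 0, \<dots>, g m\<close> whose only common
  zero is the origin.  By the Nullstellensatz there are \<open>k\<^sub>i\<close> and a matrix \<open>A\<close> over the ring of
  germs with \<open>x\<^sub>i ^ (k\<^sub>i + 1) = (\<Sum>j\<le>m. A\<^sub>i\<^sub>j g\<^sub>j)\<close>; the transformation law then gives
  the residue of \<open>h\<close> over \<open>g\<close> as that of \<open>det A \<cdot> h\<close> over the powers \<open>x\<^sub>i ^ (k\<^sub>i + 1)\<close>,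
  which by Cauchy's formula is the coefficient of the monomial \<open>x\<^sub>0 ^ k\<^sub>0 \<cdots> x\<^sub>m ^ k\<^sub>m\<close>.
  The value does not depend on the choice of \<open>k\<close> and \<open>A\<close>.
\<close>

definition grothendieck_residue ::
    "nat \<Rightarrow> complex mfps \<Rightarrow> (nat \<Rightarrow> complex mfps) \<Rightarrow> complex"
  where "grothendieck_residue m h g = (THE c. \<exists>k A.
    A \<in> carrier_mat (m + 1) (m + 1) \<and> elements_mat A \<subseteq> carrier (germ_ring m) \<and>
    (\<forall>i\<le>m. mvar i ^ (k i + 1) = (\<Sum>j\<le>m. A $$ (i, j) * g j)) \<and>
    c = mcoeff (det A * h) (\<Sum>i\<le>m. replicate_mset (k i) i))"

text \<open>
  Coefficients of \<open>dh\<close> in the frame \<open>dz/z, dy\<^sub>1, \<dots>, dy\<^sub>m\<close> of \<open>\<Omega>\<^sup>1(log D)\<close>.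
\<close>

definition log_deriv :: "nat \<Rightarrow> complex mfps \<Rightarrow> complex mfps"
  where "log_deriv k h = (if k = 0 then mvar 0 * mderiv 0 h else mderiv k h)"

text \<open>
  Row \<open>i\<close> lists the coefficients of the pull-back of the \<open>i\<close>-th frame element:
  \<open>f\<^sup>*(dz/z) = dz/z + da/a\<close> and \<open>f\<^sup>*(dy\<^sub>j) = df\<^sub>y\<^sub>j\<close>.  The entries are germs
  representing the classes modulo the fixed-point ideal; the residue below does not depend on the
  representatives.
\<close>

definition log_jacobian :: "nat \<Rightarrow> (nat \<Rightarrow> complex mfps) \<Rightarrow> complex mfps mat"
  where "log_jacobian m f = (let a = normal_factor m f in
    mat (m + 1) (m + 1) (\<lambda>(i, k).
      if i = 0 then (if k = 0 then 1 else 0) + log_deriv k a * inv\<^bsub>germ_ring m\<^esub> a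
      else log_deriv k (f i)))"

definition log_de_rham_index :: "nat \<Rightarrow> (nat \<Rightarrow> complex mfps) \<Rightarrow> complex"
  where "log_de_rham_index m f =
    grothendieck_residue m (det (1\<^sub>m (m + 1) - log_jacobian m f)) (\<lambda>i. mvar i - f i)"

end

theory Submission
  imports Defs
begin

text \<open>
  Write \<open>y\<^sub>0 = z\<close>.  The equations \<open>y\<^sub>j ^ d j = - y\<^sub>j\<^sub>-\<^sub>1\<close> make every germ congruent to a polynomial in
  \<open>y\<^sub>m\<close>, and raising them to powers gives \<open>y\<^sub>j ^ N j \<in> I\<close> for \<open>N j = (r + 1) d 1 \<cdots> d j\<close>.  The matrix
  expressing the powers \<open>y\<^sub>j ^ N j\<close> in the fixed equations is lower triangular, with explicit
  diagonal; modulo the ideal of these powers, its determinant times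
  \<open>z ^ r \<Prod> y\<^sub>j ^ (d j - 1)\<close> is the top monomial, up to the unit \<open>1 + y\<^sub>1\<close>.  This gives the index,
  because \<open>det (1 - J)\<close> is \<open>r d 1 \<cdots> d m (1 + y\<^sub>1) z ^ r \<Prod> y\<^sub>j ^ (d j - 1)\<close> up to terms divisible by
  \<open>z ^ (r + 1)\<close>.  Since the residue vanishes on \<open>I\<close>, it also shows \<open>y\<^sub>m ^ (N m - 1) \<notin> I\<close>, which
  determines the algebra and its length.  For the residue to be well defined, two transition matrices
  with the same exponents are compared by changing one row at a time.
\<close>

section \<open>Formal series\<close>

text \<open>That an element lies in \<open>I\<close> is always seen from an explicit identity; the
  obstacle is to show that one does not. This takes a linear functional vanishing on
  \<open>I\<close>, and the residue is one: by Cramer's rule \<open>det A\<close> carries every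
  generator into the monomial ideal of the powers, whose members have coefficient zero at the corner
  monomial \<open>box_top\<close>. So the computation of the index also yields the lower bound for
  the length. Infinite series are never rewritten term by term: the monomials outside a finite box
  form a convergent combination of powers lying in \<open>I\<close>, and only a polynomial is left
  to reduce. The index has the factor r where the length has r + 1, since row 0 of the Jacobian
  holds the logarithmic derivative of a = 1 - z^r (1 + y_1), and z d/dz multiplies z^r by r. The
  corner exponent of z is \<open>k 0 = r\<close>, hence everything divisible by z^(r + 1) drops out,
  including what the inverse of a contributes beyond its constant term.\<close>

lemma mcoeff_zero [simp]: "mcoeff 0 A = 0"
  and mcoeff_one: "mcoeff 1 A = (if A = {#} then 1 else 0)"
  and mcoeff_add [simp]: "mcoeff (f + g) A = mcoeff f A + mcoeff g A"
  and mcoeff_diff [simp]: "mcoeff (f - g) A = mcoeff f A - mcoeff g A"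
  and mcoeff_uminus [simp]: "mcoeff (- f) A = - mcoeff f A"
  and mcoeff_mult: "mcoeff (f * g) A = (\<Sum>B | B \<subseteq># A. mcoeff f B * mcoeff g (A - B))"
  for f g :: "'a :: comm_ring_1 mfps"
  by (simp_all add: mfps_simps)

lemma mcoeff_sum [simp]: "mcoeff (sum f S) A = (\<Sum>x\<in>S. mcoeff (f x) A)"
  for f :: "'b \<Rightarrow> 'a :: comm_ring_1 mfps"
  by (induction S rule: infinite_finite_induct) simp_all

definition mmonom :: "nat multiset \<Rightarrow> 'a::comm_ring_1 mfps"
  where "mmonom C = Abs_mfps (\<lambda>A. if A = C then 1 else 0)"

lemma mcoeff_mmonom: "mcoeff (mmonom C) A = (if A = C then 1 else 0)"
  by (simp add: mmonom_def)

lemma mcoeff_mmonom_mult: "mcoeff (mmonom C * f) A = (if C \<subseteq># A then mcoeff f (A - C) else 0)"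
proof -
  have "mcoeff (mmonom C * f) A = (\<Sum>B | B \<subseteq># A. if B = C then mcoeff f (A - B) else 0)"
    unfolding mcoeff_mult mcoeff_mmonom by (rule sum.cong) auto
  then show ?thesis by (simp add: sum.delta)
qed

lemma mmonom_mult: "mmonom A * mmonom B = mmonom (A + B)"
proof (rule mfps_eqI)
  fix C
  have "A \<subseteq># C \<Longrightarrow> C - A = B \<longleftrightarrow> C = A + B"
    by (metis add_diff_cancel_left' subset_mset.add_diff_inverse)
  then show "mcoeff (mmonom A * mmonom B) C = mcoeff (mmonom (A + B) :: 'a mfps) C"
    by (auto simp: mcoeff_mmonom_mult mcoeff_mmonom)
qed

lemma one_eq_mmonom: "1 = mmonom {#}"
  by (rule mfps_eqI) (simp add: mcoeff_one mcoeff_mmonom)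

lemma mvar_eq_mmonom: "mvar i = mmonom {#i#}"
  by (simp add: mvar_def mmonom_def)

lemma mvar_power: "mvar i ^ n = mmonom (replicate_mset n i)"
  by (induction n) (simp_all add: one_eq_mmonom mvar_eq_mmonom mmonom_mult)

lemma mcoeff_mconst_mult [simp]: "mcoeff (mconst c * f) A = c * mcoeff f A"
proof -
  have "mcoeff (mconst c * f) A = (\<Sum>B | B \<subseteq># A. if B = {#} then c * mcoeff f (A - B) else 0)"
    unfolding mcoeff_mult by (rule sum.cong) (auto simp: mconst_def)
  then show ?thesis by (simp add: sum.delta)
qed

lemma mcoeff_mconst: "mcoeff (mconst c) A = (if A = {#} then c else 0)"
  by (simp add: mconst_def)

lemma mcoeff_mult_empty: "mcoeff (f * g) {#} = mcoeff f {#} * mcoeff g {#}"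
  by (simp add: mcoeff_mult)

lemma mmonom_mult_cancel:
  assumes "mmonom C * f = mmonom C * g"
  shows "f = g"
proof (rule mfps_eqI)
  fix A
  have "mcoeff (mmonom C * f) (C + A) = mcoeff (mmonom C * g) (C + A)"
    using assms by simp
  then show "mcoeff f A = mcoeff g A" by (simp add: mcoeff_mmonom_mult)
qed

text \<open>Used to split a series into the terms divisible by some monomial and the rest;
  coefficients only get smaller, so convergence survives.\<close>

definition restrict_series :: "(nat multiset \<Rightarrow> bool) \<Rightarrow> 'a::comm_ring_1 mfps \<Rightarrow> 'a mfps"
  where "restrict_series P f = Abs_mfps (\<lambda>A. if P A then mcoeff f A else 0)"

lemma mcoeff_restrict_series [simp]:
  "mcoeff (restrict_series P f) A = (if P A then mcoeff f A else 0)"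
  by (simp add: restrict_series_def)

lemma restrict_series_split: "f = restrict_series P f + restrict_series (\<lambda>A. \<not> P A) f"
  by (rule mfps_eqI) simp

section \<open>Supports and monomial ideals\<close>

definition supported :: "nat set \<Rightarrow> 'a::comm_ring_1 mfps \<Rightarrow> bool"
  where "supported V f \<longleftrightarrow> (\<forall>A. mcoeff f A \<noteq> 0 \<longrightarrow> set_mset A \<subseteq> V)"

lemma mult_coeff_nonzeroE:
  assumes "mcoeff (f * g) A \<noteq> 0"
  obtains B C where "A = B + C" "mcoeff f B \<noteq> 0" "mcoeff g C \<noteq> 0"
proof -
  from assms obtain B where "B \<subseteq># A" "mcoeff f B * mcoeff g (A - B) \<noteq> 0"
    unfolding mcoeff_mult by (auto elim: sum.not_neutral_contains_not_neutral)
  then show ?thesis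
    by (intro that[of B "A - B"]) auto
qed

lemma supported_add: "supported V f \<Longrightarrow> supported V g \<Longrightarrow> supported V (f + g)"
  unfolding supported_def by (metis add.right_neutral mcoeff_add)

lemma supported_mult: "supported V f \<Longrightarrow> supported V g \<Longrightarrow> supported V (f * g)"
  unfolding supported_def by (metis mult_coeff_nonzeroE set_mset_union Un_least)

lemma supported_sum: "(\<And>x. x \<in> S \<Longrightarrow> supported V (f x)) \<Longrightarrow> supported V (sum f S)"
  by (induction S rule: infinite_finite_induct) (auto simp: supported_add, auto simp: supported_def)

lemma supported_mono: "supported V f \<Longrightarrow> V \<subseteq> W \<Longrightarrow> supported W f"
  unfolding supported_def by blast

text \<open>Membership in the monomial ideal generated by the \<open>x\<^sub>l ^ (k l + 1)\<close>, \<open>l \<in> J\<close>.\<close>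

definition killed :: "nat set \<Rightarrow> (nat \<Rightarrow> nat) \<Rightarrow> 'a::comm_ring_1 mfps \<Rightarrow> bool"
  where "killed J k f \<longleftrightarrow> (\<forall>A. mcoeff f A \<noteq> 0 \<longrightarrow> (\<exists>l\<in>J. k l < count A l))"

lemma killed_zero [simp]: "killed J k 0"
  by (simp add: killed_def)

lemma killed_add: "killed J k f \<Longrightarrow> killed J k g \<Longrightarrow> killed J k (f + g)"
  unfolding killed_def by (metis add.right_neutral mcoeff_add)

lemma killed_mult: "killed J k f \<Longrightarrow> killed J k (g * f)"
  unfolding killed_def by (metis mult_coeff_nonzeroE count_union trans_less_add2)

lemma killed_sum: "(\<And>x. x \<in> S \<Longrightarrow> killed J k (f x)) \<Longrightarrow> killed J k (sum f S)"
  by (induction S rule: infinite_finite_induct) (auto simp: killed_add)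

lemma killed_mvar_power: "l \<in> J \<Longrightarrow> k l < n \<Longrightarrow> killed J k (mvar l ^ n)"
  by (auto simp: killed_def mvar_power mcoeff_mmonom)

lemma killed_subset: "killed J k f \<Longrightarrow> J \<subseteq> J' \<Longrightarrow> killed J' k f"
  unfolding killed_def by blast

text \<open>The generators of the monomial ideal do not involve \<open>mvar i\<close>, so shifting a
  monomial by a power of it leaves every exponent with index in \<open>J\<close> unchanged.\<close>

lemma killed_mvar_cancel:
  assumes "killed J k (mvar i ^ n * f)" and "i \<notin> J"
  shows "killed J k f"
  unfolding killed_def
proof (intro allI impI)
  fix A assume "mcoeff f A \<noteq> 0"
  then have "mcoeff (mvar i ^ n * f) (replicate_mset n i + A) \<noteq> 0"
    by (simp add: mvar_power mcoeff_mmonom_mult)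
  then obtain l where "l \<in> J" "k l < count (replicate_mset n i + A) l"
    using assms(1) unfolding killed_def by blast
  with assms(2) show "\<exists>l\<in>J. k l < count A l" by (metis count_replicate_mset count_union add_0)
qed

lemma mcoeff_mvar_power_empty: "0 < n \<Longrightarrow> mcoeff (mvar i ^ n) {#} = 0"
  by (auto simp: mvar_power mcoeff_mmonom)

lemma supported_mvar_power: "i \<in> V \<Longrightarrow> supported V (mvar i ^ n)"
  by (auto simp: supported_def mvar_power mcoeff_mmonom)

lemma supported_mvar: "i \<in> V \<Longrightarrow> supported V (mvar i)"
  using supported_mvar_power[of i V 1] by simp

lemma mconst_0 [simp]: "mconst 0 = 0" and mconst_1 [simp]: "mconst 1 = 1"
  by (auto intro!: mfps_eqI simp: mcoeff_mconst mcoeff_one)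

lemma mconst_mult: "mconst (a * b) = mconst a * mconst b"
  by (rule mfps_eqI) (simp add: mcoeff_mconst)

lemma mconst_add: "mconst (a + b) = mconst a + mconst b"
  by (rule mfps_eqI) (simp add: mcoeff_mconst)

lemma mconst_uminus: "mconst (- a) = - mconst a"
  by (rule mfps_eqI) (simp add: mcoeff_mconst)

lemma mconst_power: "mconst (a ^ n) = mconst a ^ n"
  by (induction n) (simp_all add: mconst_mult)

lemma inj_mvar_power: "inj (\<lambda>e. mvar i ^ e :: 'a::comm_ring_1 mfps)"
proof (rule injI)
  fix e e' assume "mvar i ^ e = (mvar i ^ e' :: 'a mfps)"
  then have "mcoeff (mmonom (replicate_mset e i) :: 'a mfps) (replicate_mset e' i)
      = mcoeff (mmonom (replicate_mset e' i) :: 'a mfps) (replicate_mset e' i)"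
    by (simp add: mvar_power)
  then have "replicate_mset e' i = replicate_mset e i"
    by (simp add: mcoeff_mmonom split: if_splits)
  then show "e = e'" by (metis size_replicate_mset)
qed

section \<open>Convergent series\<close>

text \<open>Absolute convergence with sum at most \<open>K\<close>, phrased without infinite sums.\<close>

definition majorized :: "real \<Rightarrow> real \<Rightarrow> complex mfps \<Rightarrow> bool"
  where "majorized \<rho> K f \<longleftrightarrow>
    (\<forall>F. finite F \<longrightarrow> (\<Sum>A\<in>F. norm (mcoeff f A) * \<rho> ^ size A) \<le> K)"

lemma majorizedD: "majorized \<rho> K f \<Longrightarrow> finite F \<Longrightarrow> (\<Sum>A\<in>F. norm (mcoeff f A) * \<rho> ^ size A) \<le> K"
  by (simp add: majorized_def)

lemma majorized_nonneg: "majorized \<rho> K f \<Longrightarrow> 0 \<le> K"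
  using majorizedD[of \<rho> K f "{}"] by simp

lemma summable_iff_majorized:
  assumes "\<rho> > 0"
  shows "(\<lambda>A. norm (mcoeff f A) * \<rho> ^ size A) summable_on UNIV \<longleftrightarrow> (\<exists>K. majorized \<rho> K f)"
    (is "?g summable_on UNIV \<longleftrightarrow> _")
proof
  assume s: "?g summable_on UNIV"
  have "majorized \<rho> (infsum ?g UNIV) f"
    unfolding majorized_def
    by (intro allI impI finite_sum_le_infsum[OF s]) (use assms in auto)
  then show "\<exists>K. majorized \<rho> K f" ..
next
  assume "\<exists>K. majorized \<rho> K f"
  then obtain K where "majorized \<rho> K f" ..
  then show "?g summable_on UNIV"
    by (intro nonneg_bdd_above_summable_on bdd_aboveI2[where M = K])
      (use assms in \<open>auto simp: majorized_def\<close>)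
qed

lemma conv_series_iff:
  "f \<in> conv_series V \<longleftrightarrow> supported V f \<and> (\<exists>\<rho>>0. \<exists>K. majorized \<rho> K f)"
  unfolding conv_series_def supported_def using summable_iff_majorized by auto

lemma conv_seriesI: "supported V f \<Longrightarrow> majorized \<rho> K f \<Longrightarrow> 0 < \<rho> \<Longrightarrow> f \<in> conv_series V"
  unfolding conv_series_iff by blast

lemma majorized_shrink:
  assumes "majorized \<rho> K f" "0 \<le> \<rho>'" "\<rho>' \<le> \<rho>"
  shows "majorized \<rho>' K f"
  unfolding majorized_def
proof (intro allI impI)
  fix F :: "nat multiset set" assume "finite F"
  have "(\<Sum>A\<in>F. norm (mcoeff f A) * \<rho>' ^ size A) \<le> (\<Sum>A\<in>F. norm (mcoeff f A) * \<rho> ^ size A)"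
    using assms by (intro sum_mono mult_left_mono power_mono) auto
  then show "(\<Sum>A\<in>F. norm (mcoeff f A) * \<rho>' ^ size A) \<le> K"
    using majorizedD[OF assms(1) \<open>finite F\<close>] by linarith
qed

lemma majorized_coeff_le:
  assumes "majorized \<rho> K f" "0 \<le> \<rho>" "\<And>A. norm (mcoeff g A) \<le> norm (mcoeff f A)"
  shows "majorized \<rho> K g"
  unfolding majorized_def
proof (intro allI impI)
  fix F :: "nat multiset set" assume "finite F"
  have "(\<Sum>A\<in>F. norm (mcoeff g A) * \<rho> ^ size A) \<le> (\<Sum>A\<in>F. norm (mcoeff f A) * \<rho> ^ size A)"
    using assms by (intro sum_mono mult_right_mono) auto
  then show "(\<Sum>A\<in>F. norm (mcoeff g A) * \<rho> ^ size A) \<le> K"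
    using majorizedD[OF assms(1) \<open>finite F\<close>] by linarith
qed

lemma majorized_add:
  assumes "majorized \<rho> K f" "majorized \<rho> L g" "0 \<le> \<rho>"
  shows "majorized \<rho> (K + L) (f + g)"
  unfolding majorized_def
proof (intro allI impI)
  fix F :: "nat multiset set" assume F: "finite F"
  have "(\<Sum>A\<in>F. norm (mcoeff (f + g) A) * \<rho> ^ size A)
      \<le> (\<Sum>A\<in>F. norm (mcoeff f A) * \<rho> ^ size A + norm (mcoeff g A) * \<rho> ^ size A)"
    using assms(3) by (intro sum_mono)
      (simp add: distrib_right[symmetric] mult_right_mono norm_triangle_ineq)
  then show "(\<Sum>A\<in>F. norm (mcoeff (f + g) A) * \<rho> ^ size A) \<le> K + L"
    using majorizedD[OF assms(1) F] majorizedD[OF assms(2) F] by (simp add: sum.distrib)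
qed

lemma majorized_mult:
  assumes f: "majorized \<rho> K f" and g: "majorized \<rho> L g" and \<rho>: "0 \<le> \<rho>"
  shows "majorized \<rho> (K * L) (f * g)"
  unfolding majorized_def
proof (intro allI impI)
  fix F :: "nat multiset set" assume F: "finite F"
  \<comment> \<open>\<open>G\<close> contains every divisor of a monomial in \<open>F\<close>, so
    both factors \<open>B\<close> and \<open>A - B\<close> of each term lie in it; passing to pairs
    is injective because \<open>A = B + (A - B)\<close>.\<close>
  define G where "G = (\<Union>A\<in>F. {B. B \<subseteq># A})"
  have G: "finite G" using F by (simp add: G_def)
  let ?n = "\<lambda>h A. norm (mcoeff h A) * \<rho> ^ size A"
  have "(\<Sum>A\<in>F. ?n (f * g) A) \<le> (\<Sum>A\<in>F. \<Sum>B | B \<subseteq># A. ?n f B * ?n g (A - B))"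
  proof (rule sum_mono)
    fix A
    have "norm (mcoeff (f * g) A) \<le> (\<Sum>B | B \<subseteq># A. norm (mcoeff f B) * norm (mcoeff g (A - B)))"
      unfolding mcoeff_mult by (rule order_trans[OF norm_sum]) (simp add: norm_mult)
    then have "?n (f * g) A \<le> (\<Sum>B | B \<subseteq># A. norm (mcoeff f B) * norm (mcoeff g (A - B))) * \<rho> ^ size A"
      by (rule mult_right_mono) (use \<rho> in simp)
    also have "\<dots> = (\<Sum>B | B \<subseteq># A. ?n f B * ?n g (A - B))"
      unfolding sum_distrib_right
    proof (rule sum.cong)
      fix B assume "B \<in> {B. B \<subseteq># A}"
      then have "size A = size B + size (A - B)"
        by (metis mem_Collect_eq size_union subset_mset.add_diff_inverse)
      then show "norm (mcoeff f B) * norm (mcoeff g (A - B)) * \<rho> ^ size A = ?n f B * ?n g (A - B)"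
        by (simp add: power_add)
    qed simp
    finally show "?n (f * g) A \<le> (\<Sum>B | B \<subseteq># A. ?n f B * ?n g (A - B))" .
  qed
  also have "\<dots> = (\<Sum>(A, B) \<in> (SIGMA A:F. {B. B \<subseteq># A}). ?n f B * ?n g (A - B))"
    using F by (subst sum.Sigma) auto
  also have "\<dots> = (\<Sum>(B, C) \<in> (\<lambda>(A, B). (B, A - B)) ` (SIGMA A:F. {B. B \<subseteq># A}). ?n f B * ?n g C)"
    by (subst sum.reindex) (auto simp: inj_on_def case_prod_unfold dest: subset_mset.add_diff_inverse)
  also have "\<dots> \<le> (\<Sum>(B, C) \<in> G \<times> G. ?n f B * ?n g C)"
    using G \<rho> by (intro sum_mono2) (auto simp: G_def)
  also have "\<dots> = (\<Sum>B\<in>G. ?n f B) * (\<Sum>C\<in>G. ?n g C)"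
    by (simp add: sum_product sum.cartesian_product)
  also have "\<dots> \<le> K * L"
    using majorizedD[OF f G] majorizedD[OF g G] \<rho> majorized_nonneg[OF f]
    by (intro mult_mono) (auto intro!: sum_nonneg)
  finally show "(\<Sum>A\<in>F. ?n (f * g) A) \<le> K * L" .
qed

lemma majorized_mmonom: "majorized \<rho> (\<rho> ^ size C) (mmonom C)" if "0 \<le> \<rho>"
  unfolding majorized_def
proof (intro allI impI)
  fix F :: "nat multiset set" assume F: "finite F"
  have "(\<Sum>A\<in>F. norm (mcoeff (mmonom C :: complex mfps) A) * \<rho> ^ size A) = (\<Sum>A\<in>F. if A = C then \<rho> ^ size A else 0)"
    by (rule sum.cong) (auto simp: mcoeff_mmonom)
  also have "\<dots> \<le> \<rho> ^ size C" using F that by (simp add: sum.delta)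
  finally show "(\<Sum>A\<in>F. norm (mcoeff (mmonom C :: complex mfps) A) * \<rho> ^ size A) \<le> \<rho> ^ size C" .
qed

lemma conv_series_mono: "V \<subseteq> W \<Longrightarrow> conv_series V \<subseteq> conv_series W"
  by (auto simp: conv_series_iff intro: supported_mono)

lemma mmonom_in_conv: "set_mset A \<subseteq> V \<Longrightarrow> mmonom A \<in> conv_series V"
  using majorized_mmonom[of 1 A] unfolding conv_series_iff
  by (auto simp: supported_def mcoeff_mmonom intro!: exI[of _ 1])

lemma mvar_in_conv: "i \<in> V \<Longrightarrow> mvar i \<in> conv_series V"
  by (simp add: mvar_eq_mmonom mmonom_in_conv)

lemma conv_series_common:
  assumes "f \<in> conv_series V" "g \<in> conv_series V"
  obtains \<rho> K L where "\<rho> > 0" "majorized \<rho> K f" "majorized \<rho> L g"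
proof -
  obtain \<rho>1 K \<rho>2 L where "\<rho>1 > 0" "majorized \<rho>1 K f" "\<rho>2 > 0" "majorized \<rho>2 L g"
    using assms unfolding conv_series_iff by auto
  then have "majorized (min \<rho>1 \<rho>2) K f" "majorized (min \<rho>1 \<rho>2) L g" "min \<rho>1 \<rho>2 > 0"
    by (simp_all add: majorized_shrink)
  then show ?thesis by (intro that)
qed

lemma add_in_conv: "f \<in> conv_series V \<Longrightarrow> g \<in> conv_series V \<Longrightarrow> f + g \<in> conv_series V"
  by (rule conv_series_common[of f V g], assumption+, unfold conv_series_iff)
    (metis less_imp_le majorized_add supported_add)

lemma mult_in_conv: "f \<in> conv_series V \<Longrightarrow> g \<in> conv_series V \<Longrightarrow> f * g \<in> conv_series V"
  by (rule conv_series_common[of f V g], assumption+, unfold conv_series_iff)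
    (metis less_imp_le majorized_mult supported_mult)

lemma coeff_le_in_conv:
  assumes "f \<in> conv_series V" "\<And>A. norm (mcoeff g A) \<le> norm (mcoeff f A)"
  shows "g \<in> conv_series V"
proof -
  have "supported V g"
    using assms unfolding conv_series_iff supported_def
    by (metis norm_le_zero_iff norm_zero)
  then show ?thesis
    using assms unfolding conv_series_iff by (meson less_imp_le majorized_coeff_le)
qed

lemma zero_in_conv: "0 \<in> conv_series V"
proof -
  have "majorized 1 0 0" by (simp add: majorized_def)
  then show ?thesis by (rule conv_seriesI[rotated]) (simp_all add: supported_def)
qed

lemma one_in_conv: "1 \<in> conv_series V"
  by (simp add: one_eq_mmonom mmonom_in_conv)

lemma uminus_in_conv: "f \<in> conv_series V \<Longrightarrow> - f \<in> conv_series V"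
  by (erule coeff_le_in_conv) simp

lemma diff_in_conv: "f \<in> conv_series V \<Longrightarrow> g \<in> conv_series V \<Longrightarrow> f - g \<in> conv_series V"
  by (metis add_in_conv uminus_in_conv add_uminus_conv_diff)

lemma power_in_conv: "f \<in> conv_series V \<Longrightarrow> f ^ n \<in> conv_series V"
  by (induction n) (auto intro: one_in_conv mult_in_conv)

lemma sum_in_conv: "(\<And>x. x \<in> S \<Longrightarrow> f x \<in> conv_series V) \<Longrightarrow> sum f S \<in> conv_series V"
  by (induction S rule: infinite_finite_induct) (auto intro: zero_in_conv add_in_conv)

lemma prod_in_conv: "(\<And>x. x \<in> S \<Longrightarrow> f x \<in> conv_series V) \<Longrightarrow> prod f S \<in> conv_series V"
  by (induction S rule: infinite_finite_induct) (auto intro: one_in_conv mult_in_conv)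

lemma restrict_in_conv: "f \<in> conv_series V \<Longrightarrow> restrict_series P f \<in> conv_series V"
  by (erule coeff_le_in_conv) simp

lemma mconst_in_conv: "mconst c \<in> conv_series V"
proof -
  have "majorized 1 (norm c) (mconst c)"
    unfolding majorized_def
  proof (intro allI impI)
    fix F :: "nat multiset set" assume F: "finite F"
    have "(\<Sum>A\<in>F. norm (mcoeff (mconst c) A) * 1 ^ size A) = (\<Sum>A\<in>F. if A = {#} then norm c else 0)"
      by (rule sum.cong) (auto simp: mcoeff_mconst)
    also have "\<dots> \<le> norm c" using F by (simp add: sum.delta)
    finally show "(\<Sum>A\<in>F. norm (mcoeff (mconst c) A) * 1 ^ size A) \<le> norm c" .
  qed
  then show ?thesis
    by (rule conv_seriesI[rotated]) (simp_all add: supported_def mcoeff_mconst)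
qed

lemmas conv_intros = zero_in_conv one_in_conv add_in_conv mult_in_conv uminus_in_conv diff_in_conv
  power_in_conv sum_in_conv prod_in_conv mvar_in_conv mmonom_in_conv mconst_in_conv restrict_in_conv

text \<open>Dividing by \<open>C\<close> lowers every degree by \<open>size C\<close>, which costs
  the constant factor \<open>1 / \<rho> ^ size C\<close> in the bound while the radius stays the
  same.\<close>

lemma conv_series_mmonom_dvd:
  assumes f: "f \<in> conv_series V" and C: "\<And>A. mcoeff f A \<noteq> 0 \<Longrightarrow> C \<subseteq># A"
  obtains g where "g \<in> conv_series V" "f = mmonom C * g"
proof
  define g where "g = Abs_mfps (\<lambda>A. mcoeff f (A + C))"
  show "f = mmonom C * g"
    by (rule mfps_eqI) (auto simp: mcoeff_mmonom_mult g_def C intro: ccontr)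
  obtain \<rho> K where \<rho>: "\<rho> > 0" and K: "majorized \<rho> K f"
    using f unfolding conv_series_iff by auto
  have "majorized \<rho> (K / \<rho> ^ size C) g"
    unfolding majorized_def
  proof (intro allI impI)
    fix F :: "nat multiset set" assume F: "finite F"
    have "(\<Sum>A\<in>F. norm (mcoeff g A) * \<rho> ^ size A) * \<rho> ^ size C
        = (\<Sum>A\<in>(\<lambda>A. A + C) ` F. norm (mcoeff f A) * \<rho> ^ size A)"
      by (subst sum.reindex) (auto simp: inj_on_def sum_distrib_right g_def power_add mult.assoc)
    also have "\<dots> \<le> K" using majorizedD[OF K] F by blast
    finally show "(\<Sum>A\<in>F. norm (mcoeff g A) * \<rho> ^ size A) \<le> K / \<rho> ^ size C"
      using \<rho> by (simp add: field_simps)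
  qed
  moreover have "supported V g"
    using f unfolding conv_series_iff supported_def g_def by (metis le_sup_iff mcoeff_Abs set_mset_union)
  ultimately show "g \<in> conv_series V"
    using \<rho> unfolding conv_series_iff by blast
qed

text \<open>Without a constant term each factor raises the degree by at least one. This makes the
  geometric series of \<open>g\<close> a finite sum in every coefficient.\<close>

lemma mcoeff_power_eq_0:
  assumes "mcoeff g {#} = 0" and "size A < n"
  shows "mcoeff (g ^ n) A = 0"
  using assms(2)
proof (induction n arbitrary: A)
  case (Suc n)
  show ?case
  proof (rule ccontr)
    assume "mcoeff (g ^ Suc n) A \<noteq> 0"
    then obtain B C where BC: "A = B + C" "mcoeff g B \<noteq> 0" "mcoeff (g ^ n) C \<noteq> 0"
      unfolding power_Suc by (rule mult_coeff_nonzeroE)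
    then have "B \<noteq> {#}" using assms(1) by auto
    with BC(1) Suc.prems have "size C < n"
      using nonempty_has_size[of B] by auto
    with Suc.IH BC(3) show False by blast
  qed
qed simp

lemma majorized_one: "majorized \<rho> 1 1" if "0 \<le> \<rho>"
  using majorized_mmonom[OF that, of "{#}"] by (simp add: one_eq_mmonom)

lemma majorized_power:
  assumes "majorized \<rho> K g" "0 \<le> \<rho>"
  shows "majorized \<rho> (K ^ n) (g ^ n)"
  by (induction n) (use assms in \<open>auto intro: majorized_one majorized_mult\<close>)

lemma majorized_small:
  assumes "f \<in> conv_series V" and "mcoeff f {#} = 0"
  obtains \<rho> where "\<rho> > 0" "majorized \<rho> (1/2) f"
proof -
  obtain \<rho> K where \<rho>: "\<rho> > 0" and K: "majorized \<rho> K f"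
    using assms(1) unfolding conv_series_iff by auto
  \<comment> \<open>Every monomial that occurs has degree at least one, so shrinking the radius by
    \<open>t \<le> 1\<close> gains a factor \<open>t\<close>; \<open>K + 1\<close> instead of
    \<open>K\<close> ensures \<open>t \<le> 1\<close> for small \<open>K\<close>.\<close>
  define t where "t = 1 / (2 * (K + 1))"
  have K0: "0 \<le> K" using majorized_nonneg[OF K] .
  then have t: "0 < t" "t \<le> 1" "t * K \<le> 1/2" by (auto simp: t_def field_simps)
  have "majorized (t * \<rho>) (1/2) f"
    unfolding majorized_def
  proof (intro allI impI)
    fix F :: "nat multiset set" assume F: "finite F"
    have "(\<Sum>A\<in>F. norm (mcoeff f A) * (t * \<rho>) ^ size A) \<le> (\<Sum>A\<in>F. t * (norm (mcoeff f A) * \<rho> ^ size A))"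
    proof (rule sum_mono)
      fix A
      show "norm (mcoeff f A) * (t * \<rho>) ^ size A \<le> t * (norm (mcoeff f A) * \<rho> ^ size A)"
      proof (cases "A = {#}")
        case False
        then have "t ^ size A \<le> t ^ 1"
          using t by (intro power_decreasing) (auto simp: Suc_le_eq nonempty_has_size[symmetric])
        then have "t ^ size A * (norm (mcoeff f A) * \<rho> ^ size A) \<le> t * (norm (mcoeff f A) * \<rho> ^ size A)"
          using \<rho> by (intro mult_right_mono) auto
        then show ?thesis by (simp add: power_mult_distrib mult_ac)
      qed (simp add: assms(2))
    qed
    also have "\<dots> \<le> t * K"
      using majorizedD[OF K F] t by (simp add: sum_distrib_left[symmetric])
    finally show "(\<Sum>A\<in>F. norm (mcoeff f A) * (t * \<rho>) ^ size A) \<le> 1/2" using t by linarith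
  qed
  with t \<rho> show ?thesis by (intro that[of "t * \<rho>"]) auto
qed

text \<open>The inverse is the geometric series of \<open>g\<close>, truncated coefficientwise where it is constant.\<close>

lemma conv_series_inverse:
  assumes g: "g \<in> conv_series V" and g0: "mcoeff g {#} = 0"
  obtains b where "b \<in> conv_series V" "(1 - g) * b = 1"
proof
  define s where "s = (\<lambda>K. \<Sum>n\<le>K. g ^ n)"
  define b where "b = Abs_mfps (\<lambda>A. mcoeff (s (size A)) A)"
  have coeff_b: "mcoeff b A = mcoeff (s K) A" if "size A \<le> K" for A K
  proof -
    have "(\<Sum>n\<le>size A. mcoeff (g ^ n) A) = (\<Sum>n\<le>K. mcoeff (g ^ n) A)"
      using that by (intro sum.mono_neutral_left) (auto intro: mcoeff_power_eq_0[OF g0])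
    then show ?thesis by (simp add: b_def s_def)
  qed
  show "(1 - g) * b = 1"
  proof (rule mfps_eqI)
    fix A
    have "mcoeff ((1 - g) * b) A = mcoeff ((1 - g) * s (size A)) A"
      unfolding mcoeff_mult
      by (rule sum.cong) (auto intro!: arg_cong[where f = "(*) _"] coeff_b size_mset_mono)
    also have "(1 - g) * s (size A) = 1 - g ^ Suc (size A)"
      unfolding s_def by (metis lessThan_Suc_atMost one_diff_power_eq)
    also have "mcoeff \<dots> A = mcoeff 1 A"
      using mcoeff_power_eq_0[OF g0, of A "Suc (size A)"] by simp
    finally show "mcoeff ((1 - g) * b) A = mcoeff 1 A" .
  qed
  obtain \<rho> where \<rho>: "\<rho> > 0" and maj: "majorized \<rho> (1/2) g"
    using majorized_small[OF g g0] .
  \<comment> \<open>The value is 1 + 1/2 + ... + (1/2)^K, bounded by 2 independently of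
    \<open>K\<close>; on a finite set of monomials \<open>b\<close> agrees with a single
    \<open>s K\<close>.\<close>
  have s_maj: "majorized \<rho> (2 - (1/2) ^ K) (s K)" for K
  proof (induction K)
    case 0
    show ?case using majorized_one \<rho> by (simp add: s_def)
  next
    case (Suc K)
    have "majorized \<rho> (2 - (1/2) ^ K + (1/2) ^ Suc K) (s K + g ^ Suc K)"
      using Suc majorized_power[OF maj, of "Suc K"] \<rho> by (intro majorized_add) auto
    moreover have "(2 - (1/2) ^ K + (1/2) ^ Suc K :: real) = 2 - (1/2) ^ Suc K" by simp
    ultimately show ?case by (simp add: s_def)
  qed
  have "majorized \<rho> 2 b"
    unfolding majorized_def
  proof (intro allI impI)
    fix F :: "nat multiset set" assume F: "finite F"
    define K where "K = Max (insert 0 (size ` F))"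
    have "(\<Sum>A\<in>F. norm (mcoeff b A) * \<rho> ^ size A) = (\<Sum>A\<in>F. norm (mcoeff (s K) A) * \<rho> ^ size A)"
    proof (rule sum.cong)
      fix A assume "A \<in> F"
      with F have "size A \<le> K" by (simp add: K_def)
      then show "norm (mcoeff b A) * \<rho> ^ size A = norm (mcoeff (s K) A) * \<rho> ^ size A"
        by (simp add: coeff_b)
    qed simp
    also have "\<dots> \<le> 2 - (1/2) ^ K" by (rule majorizedD[OF s_maj F])
    also have "\<dots> \<le> 2" by simp
    finally show "(\<Sum>A\<in>F. norm (mcoeff b A) * \<rho> ^ size A) \<le> 2" .
  qed
  moreover have "supported V b"
    unfolding supported_def
  proof (intro allI impI)
    fix A assume "mcoeff b A \<noteq> 0"
    moreover have "s (size A) \<in> conv_series V"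
      unfolding s_def using g by (intro conv_intros)
    ultimately show "set_mset A \<subseteq> V"
      by (auto simp: b_def conv_series_iff supported_def)
  qed
  ultimately show "b \<in> conv_series V" using \<rho> unfolding conv_series_iff by blast
qed

section \<open>Independence of the residue of the transition matrix\<close>

text \<open>Row \<open>j\<close> of the identity between \<open>adj_mat A * A\<close> and
  \<open>det A\<close> times the unit matrix, applied to the vector \<open>g\<close>:
  \<open>det A\<close> multiplies each \<open>g j\<close> into the ideal generated by the entries of
  \<open>A\<close> times \<open>g\<close>.\<close>

lemma det_mult_eq_adj_combination:
  fixes A :: "'a::comm_ring_1 mat"
  assumes A: "A \<in> carrier_mat n n" and j: "j < n"
  shows "det A * g j = (\<Sum>i<n. adj_mat A $$ (j, i) * (\<Sum>l<n. A $$ (i, l) * g l))"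
proof -
  have adj: "adj_mat A \<in> carrier_mat n n" using adj_mat(1)[OF A] .
  have entry: "(\<Sum>i<n. adj_mat A $$ (j, i) * A $$ (i, l)) = (if l = j then det A else 0)" if "l < n" for l
  proof -
    have "(\<Sum>i<n. adj_mat A $$ (j, i) * A $$ (i, l)) = (adj_mat A * A) $$ (j, l)"
      using A adj j that by (simp add: scalar_prod_def lessThan_atLeast0)
    also have "\<dots> = (if l = j then det A else 0)"
      using j that by (simp add: adj_mat(3)[OF A])
    finally show ?thesis .
  qed
  have "(\<Sum>i<n. adj_mat A $$ (j, i) * (\<Sum>l<n. A $$ (i, l) * g l))
      = (\<Sum>l<n. \<Sum>i<n. adj_mat A $$ (j, i) * A $$ (i, l) * g l)"
    unfolding sum_distrib_left mult.assoc by (rule sum.swap)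
  also have "\<dots> = (\<Sum>l<n. if l = j then det A * g l else 0)"
    by (rule sum.cong) (simp_all add: sum_distrib_right[symmetric] entry)
  also have "\<dots> = det A * g j" using j by simp
  finally show ?thesis by simp
qed

text \<open>By Cramer's rule \<open>det A\<close> multiplies every \<open>g j\<close>, hence also \<open>x\<^sub>i ^ p\<close>, into a monomial ideal
  not involving \<open>x\<^sub>i\<close>, modulo which \<open>x\<^sub>i\<close> is not a zero divisor.\<close>

lemma killed_det_zero_row:
  fixes A :: "'a::comm_ring_1 mfps mat"
  assumes A: "A \<in> carrier_mat n n" and i: "i < n"
    and rows: "\<And>l. l < n \<Longrightarrow> l \<noteq> i \<Longrightarrow> (\<Sum>j<n. A $$ (l, j) * g j) = mvar l ^ (k l + 1)"
    and row_i: "(\<Sum>j<n. A $$ (i, j) * g j) = 0"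
    and power: "mvar i ^ p = (\<Sum>j<n. c j * g j)"
  shows "killed ({..<n} - {i}) k (det A)"
proof -
  have "killed ({..<n} - {i}) k (\<Sum>j<n. A $$ (l, j) * g j)" if "l < n" for l
    by (cases "l = i") (auto simp: row_i rows that simp del: power_Suc intro!: killed_mvar_power)
  then have "killed ({..<n} - {i}) k (det A * g j)" if "j < n" for j
    unfolding det_mult_eq_adj_combination[OF A that] by - (rule killed_sum, rule killed_mult, simp)
  then have "killed ({..<n} - {i}) k (\<Sum>j<n. c j * (det A * g j))"
    by - (rule killed_sum, rule killed_mult, simp)
  also have "(\<Sum>j<n. c j * (det A * g j)) = mvar i ^ p * det A"
    unfolding power sum_distrib_right by (simp add: mult_ac)
  finally show ?thesis by (rule killed_mvar_cancel) simp
qed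

text \<open>The determinant is linear in row \<open>i\<close>, so the difference is the determinant
  of a matrix whose row \<open>i\<close> is the difference of the two rows. That row annihilates
  \<open>g\<close>, since both rows represent the same power.\<close>

lemma killed_det_diff_row:
  fixes A B :: "'a::comm_ring_1 mfps mat"
  assumes A: "A \<in> carrier_mat n n" and B: "B \<in> carrier_mat n n" and i: "i < n"
    and rows_A: "\<And>l. l < n \<Longrightarrow> (\<Sum>j<n. A $$ (l, j) * g j) = mvar l ^ (k l + 1)"
    and row_B: "(\<Sum>j<n. B $$ (i, j) * g j) = mvar i ^ (k i + 1)"
    and same: "\<And>l j. l < n \<Longrightarrow> j < n \<Longrightarrow> l \<noteq> i \<Longrightarrow> B $$ (l, j) = A $$ (l, j)"
  shows "killed {..<n} k (det A - det B)"
proof -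
  define C where "C = mat n n (\<lambda>(l, j). if l = i then A $$ (i, j) - B $$ (i, j) else A $$ (l, j))"
  have C: "C \<in> carrier_mat n n" by (simp add: C_def)
  have "mat_delete B i j = mat_delete A i j" "mat_delete C i j = mat_delete A i j" if "j < n" for j
    using A B that i by (auto simp: mat_delete_def C_def same intro!: eq_matI)
  then have cof: "cofactor B i j = cofactor A i j" "cofactor C i j = cofactor A i j" if "j < n" for j
    using that by (simp_all add: cofactor_def)
  have "det A - det B = det C"
    unfolding laplace_expansion_row[OF A i] laplace_expansion_row[OF B i] laplace_expansion_row[OF C i]
    unfolding sum_subtractf[symmetric]
    by (rule sum.cong) (use i in \<open>simp_all add: cof, simp_all add: C_def left_diff_distrib\<close>)
  moreover have "killed ({..<n} - {i}) k (det C)"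
  proof (rule killed_det_zero_row[OF C i])
    show "(\<Sum>j<n. C $$ (l, j) * g j) = mvar l ^ (k l + 1)" if "l < n" "l \<noteq> i" for l
      using rows_A[OF that(1)] that by (simp add: C_def)
    show "(\<Sum>j<n. C $$ (i, j) * g j) = 0"
      using i rows_A[OF i] row_B by (simp add: C_def left_diff_distrib sum_subtractf)
    show "mvar i ^ (k i + 1) = (\<Sum>j<n. A $$ (i, j) * g j)"
      using rows_A[OF i] by simp
  qed
  ultimately show ?thesis by (auto intro: killed_subset)
qed

lemma killed_det_diff:
  fixes A B :: "'a::comm_ring_1 mfps mat"
  assumes A: "A \<in> carrier_mat n n" and B: "B \<in> carrier_mat n n"
    and rows_A: "\<And>l. l < n \<Longrightarrow> (\<Sum>j<n. A $$ (l, j) * g j) = mvar l ^ (k l + 1)"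
    and rows_B: "\<And>l. l < n \<Longrightarrow> (\<Sum>j<n. B $$ (l, j) * g j) = mvar l ^ (k l + 1)"
  shows "killed {..<n} k (det A - det B)"
proof -
  define C where "C = (\<lambda>t. mat n n (\<lambda>(l, j). if l < t then B $$ (l, j) else A $$ (l, j)))"
  have C: "C t \<in> carrier_mat n n" for t by (simp add: C_def)
  have rows_C: "(\<Sum>j<n. C t $$ (l, j) * g j) = mvar l ^ (k l + 1)" if "l < n" for t l
    using rows_A[OF that] rows_B[OF that] that by (cases "l < t") (simp_all add: C_def)
  have "killed {..<n} k (det A - det (C t))" if "t \<le> n" for t
    using that
  proof (induction t)
    case 0
    have "C 0 = A" using A by (auto simp: C_def intro!: eq_matI)
    then show ?case by simp
  next
    case (Suc t)
    then have t: "t < n" by simp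
    have "killed {..<n} k (det (C t) - det (C (Suc t)))"
      by (rule killed_det_diff_row[OF C C t rows_C rows_C[OF t]]) (auto simp: C_def)
    with Suc have "killed {..<n} k ((det A - det (C t)) + (det (C t) - det (C (Suc t))))"
      by (intro killed_add) auto
    then show ?case by simp
  qed
  moreover have "C n = B" using B by (auto simp: C_def intro!: eq_matI)
  ultimately show ?thesis by (metis order_refl)
qed

text \<open>The corner of the exponent box: a monomial in the first \<open>n\<close> variables
  avoids the ideal of the powers \<open>mvar i ^ (k i + 1)\<close> exactly if it divides this
  one.\<close>

definition box_top :: "nat \<Rightarrow> (nat \<Rightarrow> nat) \<Rightarrow> nat multiset"
  where "box_top n k = (\<Sum>i<n. replicate_mset (k i) i)"

lemma count_box_top: "count (box_top n k) i = (if i < n then k i else 0)"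
proof -
  have "count (box_top n k) i = (\<Sum>j<n. if j = i then k j else 0)"
    unfolding box_top_def count_sum by (rule sum.cong) auto
  then show ?thesis by simp
qed

lemma mcoeff_box_top_killed:
  assumes "killed {..<n} k f"
  shows "mcoeff f (box_top n k) = 0"
proof (rule ccontr)
  assume "mcoeff f (box_top n k) \<noteq> 0"
  then obtain l where "l < n" "k l < count (box_top n k) l"
    using assms unfolding killed_def by blast
  then show False by (simp add: count_box_top)
qed

lemma prod_mvar_power: "(\<Prod>i<n. mvar i ^ p i) = mmonom (box_top n p)"
  by (induction n) (simp_all add: box_top_def one_eq_mmonom mvar_power mmonom_mult)

lemma det_diag:
  fixes p :: "nat \<Rightarrow> 'a::comm_ring_1"
  shows "det (mat n n (\<lambda>(i, j). if i = j then p i else 0)) = (\<Prod>i<n. p i)"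
  by (subst det_lower_triangular[of n]) (auto simp: prod_list_diag_prod lessThan_atLeast0)

text \<open>Multiplying row \<open>i\<close> by \<open>mvar i ^ p i\<close> multiplies the
  determinant by a monomial and moves the corner by the same amount. This brings two transition
  matrices with different exponents to common ones.\<close>

lemma residue_coeff_raise_exponents:
  fixes A :: "'a::comm_ring_1 mfps mat"
  assumes A: "A \<in> carrier_mat n n"
    and rows: "\<And>i. i < n \<Longrightarrow> (\<Sum>j<n. A $$ (i, j) * g j) = mvar i ^ (k i + 1)"
  obtains B where "B \<in> carrier_mat n n"
    "\<And>i. i < n \<Longrightarrow> (\<Sum>j<n. B $$ (i, j) * g j) = mvar i ^ (p i + k i + 1)"
    "\<And>h. mcoeff (det B * h) (box_top n (\<lambda>i. p i + k i)) = mcoeff (det A * h) (box_top n k)"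
proof
  define D :: "'a mfps mat" where "D = mat n n (\<lambda>(i, j). if i = j then mvar i ^ p i else 0)"
  have D: "D \<in> carrier_mat n n" by (simp add: D_def)
  show DA: "D * A \<in> carrier_mat n n" using D A by simp
  have entry: "(D * A) $$ (i, j) = mvar i ^ p i * A $$ (i, j)" if "i < n" "j < n" for i j
  proof -
    have "(D * A) $$ (i, j) = (\<Sum>l<n. (if i = l then mvar i ^ p i else 0) * A $$ (l, j))"
      using A that by (simp add: D_def scalar_prod_def lessThan_atLeast0)
    also have "\<dots> = (\<Sum>l<n. if i = l then mvar i ^ p i * A $$ (l, j) else 0)"
      by (rule sum.cong) auto
    finally show ?thesis using that by simp
  qed
  show "(\<Sum>j<n. (D * A) $$ (i, j) * g j) = mvar i ^ (p i + k i + 1)" if "i < n" for i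
  proof -
    have "(\<Sum>j<n. (D * A) $$ (i, j) * g j) = mvar i ^ p i * (\<Sum>j<n. A $$ (i, j) * g j)"
      unfolding sum_distrib_left by (rule sum.cong) (simp_all add: entry that mult.assoc)
    then show ?thesis by (simp add: rows that power_add)
  qed
  have "box_top n (\<lambda>i. p i + k i) = box_top n p + box_top n k"
    by (simp add: multiset_eq_iff count_box_top)
  moreover have "det (D * A) = mmonom (box_top n p) * det A"
    unfolding det_mult[OF D A] by (simp add: D_def det_diag prod_mvar_power)
  ultimately show "mcoeff (det (D * A) * h) (box_top n (\<lambda>i. p i + k i)) = mcoeff (det A * h) (box_top n k)"
    for h by (simp add: mult.assoc mcoeff_mmonom_mult)
qed

lemma residue_coeff_unique:
  fixes A B :: "'a::comm_ring_1 mfps mat"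
  assumes A: "A \<in> carrier_mat n n" "\<And>i. i < n \<Longrightarrow> (\<Sum>j<n. A $$ (i, j) * g j) = mvar i ^ (k i + 1)"
    and B: "B \<in> carrier_mat n n" "\<And>i. i < n \<Longrightarrow> (\<Sum>j<n. B $$ (i, j) * g j) = mvar i ^ (l i + 1)"
  shows "mcoeff (det A * h) (box_top n k) = mcoeff (det B * h) (box_top n l)"
proof -
  obtain A' where A': "A' \<in> carrier_mat n n"
    "\<And>i. i < n \<Longrightarrow> (\<Sum>j<n. A' $$ (i, j) * g j) = mvar i ^ (l i + k i + 1)"
    "\<And>h. mcoeff (det A' * h) (box_top n (\<lambda>i. l i + k i)) = mcoeff (det A * h) (box_top n k)"
    using residue_coeff_raise_exponents[OF A, of l] by blast
  obtain B' where B': "B' \<in> carrier_mat n n"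
    "\<And>i. i < n \<Longrightarrow> (\<Sum>j<n. B' $$ (i, j) * g j) = mvar i ^ (k i + l i + 1)"
    "\<And>h. mcoeff (det B' * h) (box_top n (\<lambda>i. k i + l i)) = mcoeff (det B * h) (box_top n l)"
    using residue_coeff_raise_exponents[OF B, of k] by blast
  have "killed {..<n} (\<lambda>i. l i + k i) (det A' - det B')"
    by (rule killed_det_diff[OF A'(1) B'(1) A'(2)]) (use B'(2) in \<open>auto simp: add_ac\<close>)
  then have "killed {..<n} (\<lambda>i. l i + k i) (h * (det A' - det B'))"
    by (rule killed_mult)
  then have "mcoeff (h * (det A' - det B')) (box_top n (\<lambda>i. l i + k i)) = 0"
    by (rule mcoeff_box_top_killed)
  then have "mcoeff (det A' * h) (box_top n (\<lambda>i. l i + k i)) = mcoeff (det B' * h) (box_top n (\<lambda>i. l i + k i))"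
    by (simp add: right_diff_distrib mult.commute)
  then show ?thesis using A'(3)[of h] B'(3)[of h] by (simp add: add.commute)
qed

text \<open>One transition matrix is enough: \<open>residue_coeff_unique\<close> compares any two
  choices of exponents and matrix, which is what the definite description requires.\<close>

lemma grothendieck_residue_eqI:
  assumes A: "A \<in> carrier_mat (Suc m) (Suc m)"
    and entries: "\<And>i j. i \<le> m \<Longrightarrow> j \<le> m \<Longrightarrow> A $$ (i, j) \<in> conv_series {..m}"
    and rows: "\<And>i. i \<le> m \<Longrightarrow> (\<Sum>j<Suc m. A $$ (i, j) * g j) = mvar i ^ (k i + 1)"
  shows "grothendieck_residue m h g = mcoeff (det A * h) (box_top (Suc m) k)"
  unfolding grothendieck_residue_def
proof (rule the_equality)
  have "elements_mat A \<subseteq> carrier (germ_ring m)"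
    using A entries by (auto simp: conv_ring_def)
  then show "\<exists>k' A'. A' \<in> carrier_mat (m + 1) (m + 1) \<and> elements_mat A' \<subseteq> carrier (germ_ring m) \<and>
      (\<forall>i\<le>m. mvar i ^ (k' i + 1) = (\<Sum>j\<le>m. A' $$ (i, j) * g j)) \<and>
      mcoeff (det A * h) (box_top (Suc m) k) = mcoeff (det A' * h) (\<Sum>i\<le>m. replicate_mset (k' i) i)"
    using A rows by (intro exI[of _ k] exI[of _ A]) (simp add: box_top_def lessThan_Suc_atMost)
next
  fix c
  assume "\<exists>k' A'. A' \<in> carrier_mat (m + 1) (m + 1) \<and> elements_mat A' \<subseteq> carrier (germ_ring m) \<and>
      (\<forall>i\<le>m. mvar i ^ (k' i + 1) = (\<Sum>j\<le>m. A' $$ (i, j) * g j)) \<and>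
      c = mcoeff (det A' * h) (\<Sum>i\<le>m. replicate_mset (k' i) i)"
  then obtain k' A' where A': "A' \<in> carrier_mat (Suc m) (Suc m)"
    and rows': "\<And>i. i \<le> m \<Longrightarrow> mvar i ^ (k' i + 1) = (\<Sum>j\<le>m. A' $$ (i, j) * g j)"
    and c: "c = mcoeff (det A' * h) (box_top (Suc m) k')"
    by (auto simp: box_top_def lessThan_Suc_atMost)
  show "c = mcoeff (det A * h) (box_top (Suc m) k)"
    unfolding c by (rule residue_coeff_unique[OF A' _ A, where g = g])
      (use rows rows' in \<open>simp_all add: lessThan_Suc_atMost less_Suc_eq_le\<close>)
qed

text \<open>The easy half of local duality, again by Cramer's rule: the residue vanishes on the
  ideal of its denominators. It later shows that \<open>top_product\<close> is outside
  \<open>I\<close>.\<close>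

lemma residue_coeff_combination:
  fixes A :: "'a::comm_ring_1 mfps mat"
  assumes A: "A \<in> carrier_mat n n"
    and rows: "\<And>i. i < n \<Longrightarrow> (\<Sum>j<n. A $$ (i, j) * g j) = mvar i ^ (k i + 1)"
  shows "mcoeff (det A * (\<Sum>j<n. c j * g j)) (box_top n k) = 0"
proof (rule mcoeff_box_top_killed)
  have "killed {..<n} k (det A * g j)" if "j < n" for j
    unfolding det_mult_eq_adj_combination[OF A that]
    by (rule killed_sum, rule killed_mult) (auto simp: rows simp del: power_Suc intro: killed_mvar_power)
  then have "killed {..<n} k (\<Sum>j<n. c j * (det A * g j))"
    by - (rule killed_sum, rule killed_mult, simp)
  then show "killed {..<n} k (det A * (\<Sum>j<n. c j * g j))"
    by (simp add: sum_distrib_left mult_ac)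
qed

section \<open>Ideals and quotients of rings of convergent series\<close>

lemma conv_ring_simps [simp]:
  "carrier (conv_ring V) = conv_series V"
  "x \<otimes>\<^bsub>conv_ring V\<^esub> y = x * y" "\<one>\<^bsub>conv_ring V\<^esub> = 1"
  "\<zero>\<^bsub>conv_ring V\<^esub> = 0" "x \<oplus>\<^bsub>conv_ring V\<^esub> y = x + y"
  by (simp_all add: conv_ring_def)

lemma conv_ring_cring: "cring (conv_ring V)"
proof (rule cringI)
  show "abelian_group (conv_ring V)"
  proof (rule abelian_groupI)
    fix x assume "x \<in> carrier (conv_ring V)"
    then show "\<exists>y\<in>carrier (conv_ring V). y \<oplus>\<^bsub>conv_ring V\<^esub> x = \<zero>\<^bsub>conv_ring V\<^esub>"
      by (intro bexI[of _ "- x"]) (simp_all add: uminus_in_conv)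
  qed (auto intro: conv_intros)
  show "comm_monoid (conv_ring V)"
    by (rule comm_monoidI) (auto intro: conv_intros simp: mult_ac)
qed (simp add: distrib_right)

lemma conv_ring_ring: "ring (conv_ring V)"
  using conv_ring_cring by (rule cring.axioms)

lemma conv_ring_minus [simp]:
  assumes "x \<in> conv_series V" "y \<in> conv_series V"
  shows "x \<ominus>\<^bsub>conv_ring V\<^esub> y = x - y"
proof -
  interpret cring "conv_ring V" by (rule conv_ring_cring)
  have "\<ominus>\<^bsub>conv_ring V\<^esub> y = - y"
    by (rule minus_equality) (use assms in \<open>simp_all add: uminus_in_conv\<close>)
  then show ?thesis by (simp add: a_minus_def)
qed

context
  fixes I V
  assumes I: "ideal I (conv_ring V)"
begin

lemma conv_ideal_zero: "0 \<in> I"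
  using additive_subgroup.zero_closed[OF ideal.axioms(1)[OF I]] by simp

lemma conv_ideal_add: "x \<in> I \<Longrightarrow> y \<in> I \<Longrightarrow> x + y \<in> I"
  using additive_subgroup.a_closed[OF ideal.axioms(1)[OF I]] by simp

lemma conv_ideal_mult: "x \<in> I \<Longrightarrow> c \<in> conv_series V \<Longrightarrow> c * x \<in> I"
  using ideal.I_l_closed[OF I] by simp

lemma conv_ideal_diff: "x \<in> I \<Longrightarrow> y \<in> I \<Longrightarrow> x - y \<in> I"
  using conv_ideal_add[of x "- 1 * y"] conv_ideal_mult[of y "- 1"] by (simp add: uminus_in_conv one_in_conv)

lemma conv_ideal_sum: "(\<And>i. i \<in> S \<Longrightarrow> x i \<in> I) \<Longrightarrow> sum x S \<in> I"
  by (induction S rule: infinite_finite_induct) (auto intro: conv_ideal_zero conv_ideal_add)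

lemma conv_ideal_power_mono: "x ^ n \<in> I \<Longrightarrow> n \<le> p \<Longrightarrow> x \<in> conv_series V \<Longrightarrow> x ^ p \<in> I"
  using conv_ideal_mult[of "x ^ n" "x ^ (p - n)"] by (simp add: power_in_conv power_add[symmetric])

lemma conv_coset_eq_iff:
  assumes "x \<in> conv_series V" "y \<in> conv_series V"
  shows "I +>\<^bsub>conv_ring V\<^esub> x = I +>\<^bsub>conv_ring V\<^esub> y \<longleftrightarrow> x - y \<in> I"
  using ring.quotient_eq_iff_same_a_r_cos[OF conv_ring_ring I, of x y] assms by simp

end

lemma conv_idealI:
  assumes "I \<subseteq> conv_series V" "0 \<in> I" "\<And>x y. x \<in> I \<Longrightarrow> y \<in> I \<Longrightarrow> x + y \<in> I"
    and mult: "\<And>c x. x \<in> I \<Longrightarrow> c \<in> conv_series V \<Longrightarrow> c * x \<in> I"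
  shows "ideal I (conv_ring V)"
proof (rule idealI[OF conv_ring_ring])
  interpret cring "conv_ring V" by (rule conv_ring_cring)
  show "subgroup I (add_monoid (conv_ring V))"
  proof (rule add.subgroupI)
    fix a assume a: "a \<in> I"
    have "\<ominus>\<^bsub>conv_ring V\<^esub> a = - a"
      by (rule minus_equality) (use assms(1) a in \<open>auto intro: uminus_in_conv\<close>)
    then show "\<ominus>\<^bsub>conv_ring V\<^esub> a \<in> I"
      using mult[OF a, of "- 1"] by (simp add: uminus_in_conv one_in_conv)
  qed (use assms in auto)
qed (use mult in \<open>auto simp: mult.commute\<close>)

lemma genideal_conv_ring:
  fixes n :: nat
  assumes q: "\<And>j. j < n \<Longrightarrow> q j \<in> conv_series V"
  shows "Idl\<^bsub>conv_ring V\<^esub> (q ` {..<n}) = {\<Sum>j<n. c j * q j |c. \<forall>j<n. c j \<in> conv_series V}"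
    (is "_ = ?S")
proof
  interpret cring "conv_ring V" by (rule conv_ring_cring)
  have S: "ideal ?S (conv_ring V)"
  proof (rule conv_idealI)
    show "?S \<subseteq> conv_series V" using q by (auto intro!: conv_intros)
    show "0 \<in> ?S" by (intro CollectI exI[of _ "\<lambda>_. 0"]) (simp add: zero_in_conv)
  next
    fix x y assume "x \<in> ?S" "y \<in> ?S"
    then obtain c d where "x = (\<Sum>j<n. c j * q j)" "y = (\<Sum>j<n. d j * q j)"
      "\<forall>j<n. c j \<in> conv_series V" "\<forall>j<n. d j \<in> conv_series V" by blast
    then show "x + y \<in> ?S"
      by (intro CollectI exI[of _ "\<lambda>j. c j + d j"]) (simp add: distrib_right sum.distrib add_in_conv)
  next
    fix c x assume "x \<in> ?S" and c: "c \<in> conv_series V"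
    then obtain d where "x = (\<Sum>j<n. d j * q j)" "\<forall>j<n. d j \<in> conv_series V" by blast
    with c show "c * x \<in> ?S"
      by (intro CollectI exI[of _ "\<lambda>j. c * d j"]) (simp add: sum_distrib_left mult.assoc mult_in_conv)
  qed
  have "q i \<in> ?S" if "i < n" for i
  proof (intro CollectI exI conjI allI impI)
    show "q i = (\<Sum>j<n. (if j = i then 1 else 0) * q j)"
      using that by (simp add: if_distrib[of "\<lambda>c. c * _"] cong: if_cong)
  qed (auto intro: conv_intros)
  then show "Idl\<^bsub>conv_ring V\<^esub> (q ` {..<n}) \<subseteq> ?S"
    by (intro genideal_minimal[OF S]) auto
  have sub: "q ` {..<n} \<subseteq> carrier (conv_ring V)" using q by auto
  show "?S \<subseteq> Idl\<^bsub>conv_ring V\<^esub> (q ` {..<n})"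
    using genideal_self[OF sub]
    by (auto intro!: conv_ideal_sum[OF genideal_ideal[OF sub]] conv_ideal_mult[OF genideal_ideal[OF sub]])
qed

lemma genideal_conv_ring_ideal:
  fixes n :: nat
  shows "(\<And>j. j < n \<Longrightarrow> q j \<in> conv_series V) \<Longrightarrow> ideal (Idl\<^bsub>conv_ring V\<^esub> (q ` {..<n})) (conv_ring V)"
  by (rule ring.genideal_ideal[OF conv_ring_ring]) auto

lemma genideal_conv_ring_generator:
  fixes n :: nat
  shows "(\<And>j. j < n \<Longrightarrow> q j \<in> conv_series V) \<Longrightarrow> i < n \<Longrightarrow> q i \<in> Idl\<^bsub>conv_ring V\<^esub> (q ` {..<n})"
  using ring.genideal_self[OF conv_ring_ring, of "q ` {..<n}" V] by auto

text \<open>Each monomial is charged to the largest index below \<open>n\<close> at which its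
  exponent exceeds \<open>k\<close>. The terms charged to one index form a truncation of
  \<open>h\<close>, hence a convergent multiple of the corresponding power.\<close>

lemma killed_combination:
  assumes "h \<in> conv_series V" "killed {..<n} k h"
  shows "\<exists>c. (\<forall>j. c j \<in> conv_series V) \<and> h = (\<Sum>j<n. c j * mvar j ^ (k j + 1))"
  using assms
proof (induction n arbitrary: h)
  case 0
  then have "h = 0" by (intro mfps_eqI) (auto simp: killed_def)
  then show ?case by (intro exI[of _ "\<lambda>_. 0"]) (simp add: zero_in_conv)
next
  case (Suc n)
  let ?P = "\<lambda>A. k n < count A n"
  obtain g where g: "g \<in> conv_series V" "restrict_series ?P h = mmonom (replicate_mset (k n + 1) n) * g"
  proof (rule conv_series_mmonom_dvd)
    show "restrict_series ?P h \<in> conv_series V" using Suc.prems by (intro restrict_in_conv)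
    show "replicate_mset (k n + 1) n \<subseteq># A" if "mcoeff (restrict_series ?P h) A \<noteq> 0" for A
      using that by (auto simp flip: count_le_replicate_mset_subset_eq
        simp: Suc_le_eq simp del: replicate_mset_Suc split: if_splits)
  qed
  have "killed {..<n} k (restrict_series (\<lambda>A. \<not> ?P A) h)"
    using Suc.prems(2) unfolding killed_def by (auto simp: lessThan_Suc split: if_splits)
  then obtain c where c: "\<forall>j. c j \<in> conv_series V"
    "restrict_series (\<lambda>A. \<not> ?P A) h = (\<Sum>j<n. c j * mvar j ^ (k j + 1))"
    using Suc.IH restrict_in_conv[OF Suc.prems(1)] by blast
  have "h = (\<Sum>j<Suc n. (c(n := g)) j * mvar j ^ (k j + 1))"
    using restrict_series_split[of h ?P] unfolding g(2) c(2)
    by (simp flip: mvar_power add: algebra_simps del: replicate_mset_Suc)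
  with c(1) g(1) show ?case by (intro exI[of _ "c(n := g)"]) auto
qed

text \<open>Only finitely many monomials divide \<open>box_top n k\<close>, so a convergent series
  becomes a polynomial modulo \<open>I\<close>; all other terms fall under
  \<open>killed_combination\<close>.\<close>

lemma box_reduction:
  assumes I: "ideal I (conv_ring {..<n})" and powers: "\<And>i. i < n \<Longrightarrow> mvar i ^ (k i + 1) \<in> I"
    and h: "h \<in> conv_series {..<n}"
  shows "h - (\<Sum>A | A \<subseteq># box_top n k. mconst (mcoeff h A) * mmonom A) \<in> I"
proof -
  let ?s = "\<Sum>A | A \<subseteq># box_top n k. mconst (mcoeff h A) * mmonom A"
  have coeff_s: "mcoeff ?s B = (if B \<subseteq># box_top n k then mcoeff h B else 0)" for B
    by (simp add: mcoeff_mmonom if_distrib[of "(*) _"] sum.delta cong: if_cong)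
  have "killed {..<n} k (h - ?s)"
    unfolding killed_def
  proof (intro allI impI)
    fix A assume A: "mcoeff (h - ?s) A \<noteq> 0"
    then have "mcoeff h A \<noteq> 0" "\<not> A \<subseteq># box_top n k"
      unfolding mcoeff_diff coeff_s by (auto split: if_splits)
    have "count A i = 0" if "\<not> i < n" for i
      using h \<open>mcoeff h A \<noteq> 0\<close> that unfolding conv_series_iff supported_def
      by (metis count_eq_zero_iff lessThan_iff subsetD)
    moreover obtain l where "(if l < n then k l else 0) < count A l"
      using \<open>\<not> A \<subseteq># box_top n k\<close> unfolding subseteq_mset_def count_box_top by (auto simp: not_le)
    ultimately show "\<exists>l\<in>{..<n}. k l < count A l"
      by (intro bexI[of _ l]) (auto split: if_splits)
  qed
  moreover have "h - ?s \<in> conv_series {..<n}"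
  proof (rule diff_in_conv[OF h], rule sum_in_conv)
    fix A assume "A \<in> {A. A \<subseteq># box_top n k}"
    then have "set_mset A \<subseteq> set_mset (box_top n k)" by (simp add: set_mset_mono)
    also have "\<dots> \<subseteq> {..<n}"
      using count_box_top[of n k] by (auto simp flip: count_greater_zero_iff split: if_splits)
    finally show "mconst (mcoeff h A) * mmonom A \<in> conv_series {..<n}" by (intro conv_intros)
  qed
  ultimately obtain c where "\<forall>j. c j \<in> conv_series {..<n}" "h - ?s = (\<Sum>j<n. c j * mvar j ^ (k j + 1))"
    using killed_combination by blast
  then show ?thesis
    using powers by (auto simp del: power_Suc intro!: conv_ideal_sum[OF I] conv_ideal_mult[OF I])
qed

text \<open>The powers of \<open>t\<close> generate a chain from zero to the whole ring. If
  \<open>t [^] (N - Suc i)\<close> were a multiple of \<open>t [^] (N - i)\<close>, multiplying by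
  \<open>t [^] i\<close> would give \<open>t [^] (N - 1) = \<zero>\<close>.\<close>

lemma ring_length_ge_nilpotent:
  fixes R (structure)
  assumes "cring R" and t: "t \<in> carrier R" and nil: "t [^] N = \<zero>" and nonzero: "t [^] (N - 1) \<noteq> \<zero>"
  shows "enat N \<le> ring_length R"
proof -
  interpret cring R by fact
  define C where "C = (\<lambda>i. PIdl (t [^] (N - i)))"
  have C: "x \<in> C i \<longleftrightarrow> (\<exists>y\<in>carrier R. x = y \<otimes> t [^] (N - i))" for x i
    by (auto simp: C_def cgenideal_def)
  have "C i \<subset> C (Suc i)" if "i < N" for i
  proof
    have pow: "t [^] (N - i) = t \<otimes> t [^] (N - Suc i)"
      using that t by (metis Suc_diff_Suc nat_pow_Suc2)
    show "C i \<subseteq> C (Suc i)"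
    proof
      fix x assume "x \<in> C i"
      then obtain y where y: "y \<in> carrier R" "x = y \<otimes> t [^] (N - i)" unfolding C by blast
      then have "x = (y \<otimes> t) \<otimes> t [^] (N - Suc i)" using t by (simp add: pow m_assoc)
      then show "x \<in> C (Suc i)" unfolding C using y(1) t by blast
    qed
    have "t [^] (N - Suc i) \<notin> C i"
    proof
      assume "t [^] (N - Suc i) \<in> C i"
      then obtain y where y: "y \<in> carrier R" "t [^] (N - Suc i) = y \<otimes> t [^] (N - i)" unfolding C by blast
      then have "t [^] (N - Suc i) \<otimes> t [^] i = y \<otimes> (t [^] (N - i) \<otimes> t [^] i)"
        using t by (simp add: m_assoc)
      moreover have "N - Suc i + i = N - 1" "N - i + i = N" using that by auto
      ultimately show False using t y(1) nil nonzero by (simp add: nat_pow_mult)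
    qed
    moreover have "t [^] (N - Suc i) \<in> C (Suc i)"
      unfolding C using t by (intro bexI[of _ \<one>]) auto
    ultimately show "C i \<noteq> C (Suc i)" by blast
  qed
  moreover have "ideal (C i) R" for i
    unfolding C_def using t by (intro cgenideal_ideal) simp
  ultimately show ?thesis
    unfolding ring_length_def by (intro SUP_upper CollectI exI[of _ C]) simp
qed

text \<open>A strict chain of ideals of the quotient yields vectors in the span of \<open>T\<close>, one for each
  step, that are linearly independent.\<close>

lemma ring_length_quot_le_card:
  assumes I: "ideal I (conv_ring V)" and T: "finite T" "T \<subseteq> conv_series V"
    and red: "\<And>h. h \<in> conv_series V \<Longrightarrow> \<exists>c. h - (\<Sum>t\<in>T. mconst (c t) * t) \<in> I"
  shows "ring_length (conv_ring V Quot I) \<le> enat (card T)"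
  unfolding ring_length_def
proof (rule SUP_least)
  fix n assume "n \<in> {n. \<exists>C. (\<forall>i\<le>n. ideal (C i) (conv_ring V Quot I)) \<and> (\<forall>i<n. C i \<subset> C (Suc i))}"
  then obtain C where C: "\<And>i. i \<le> n \<Longrightarrow> ideal (C i) (conv_ring V Quot I)"
    and chain: "\<And>i. i < n \<Longrightarrow> C i \<subset> C (Suc i)" by blast
  interpret vs: vector_space "\<lambda>c f. mconst c * f"
    by unfold_locales (auto intro!: mfps_eqI simp: distrib_left distrib_right mult.assoc)
  let ?p = "\<lambda>h. I +>\<^bsub>conv_ring V\<^esub> h"
  have hom: "?p \<in> Ring.ring_hom (conv_ring V) (conv_ring V Quot I)"
    by (rule ideal.rcos_ring_hom[OF I])
  \<comment> \<open>Preimages of the ideals are complex subspaces, since constants are germs. A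
    reduced representative has the same coset, so each strict inclusion is witnessed inside the span
    of \<open>T\<close>.\<close>
  define W where "W = (\<lambda>i. {h \<in> conv_series V. ?p h \<in> C i})"
  have W: "vs.subspace (W i)" if "i \<le> n" for i
  proof (rule vs.subspaceI)
    note Ci = C[OF that]
    note sub = ideal.axioms(1)[OF Ci]
    have "?p 0 = \<zero>\<^bsub>conv_ring V Quot I\<^esub>"
      using Ring.ring_hom_zero[OF hom conv_ring_ring ideal.quotient_is_ring[OF I]] by simp
    then show "0 \<in> W i"
      using additive_subgroup.zero_closed[OF sub] by (simp add: W_def zero_in_conv)
    show "x + y \<in> W i" if "x \<in> W i" "y \<in> W i" for x y
      using Ring.ring_hom_add[OF hom, of x y] additive_subgroup.a_closed[OF sub, of "?p x" "?p y"] that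
      by (simp add: W_def add_in_conv)
    show "mconst c * x \<in> W i" if "x \<in> W i" for c x
      using Ring.ring_hom_mult[OF hom, of "mconst c" x] Ring.ring_hom_closed[OF hom, of "mconst c"] that
        ideal.I_l_closed[OF Ci, of "?p x" "?p (mconst c)"]
      by (simp add: W_def mult_in_conv mconst_in_conv)
  qed
  have "\<exists>g. g \<in> vs.span T \<and> g \<in> W (Suc i) \<and> g \<notin> W i" if i: "i < n" for i
  proof -
    obtain X where X: "X \<in> C (Suc i)" "X \<notin> C i" using chain[OF i] by blast
    have "X \<in> carrier (conv_ring V Quot I)"
      using ideal.Icarr[OF C X(1)] i by simp
    then obtain h where h: "h \<in> conv_series V" "X = ?p h"
      by (auto simp: FactRing_def A_RCOSETS_def')
    obtain c where c: "h - (\<Sum>t\<in>T. mconst (c t) * t) \<in> I" using red[OF h(1)] by blast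
    let ?g = "\<Sum>t\<in>T. mconst (c t) * t"
    have g: "?g \<in> conv_series V" using T(2) by (auto intro!: conv_intros)
    have "?p ?g = X"
      using c g h conv_coset_eq_iff[OF I h(1) g] by simp
    with X g have "?g \<in> W (Suc i)" "?g \<notin> W i" by (auto simp: W_def)
    moreover have "?g \<in> vs.span T"
      by (intro vs.span_sum vs.span_scale vs.span_base)
    ultimately show ?thesis by blast
  qed
  then obtain g where g: "\<And>i. i < n \<Longrightarrow> g i \<in> vs.span T"
    "\<And>i. i < n \<Longrightarrow> g i \<in> W (Suc i)" "\<And>i. i < n \<Longrightarrow> g i \<notin> W i" by metis
  have "vs.independent (g ` {..<j}) \<and> card (g ` {..<j}) = j \<and> g ` {..<j} \<subseteq> W j" if "j \<le> n" for j
    using that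
  proof (induction j)
    case 0
    then show ?case by (simp add: vs.independent_empty)
  next
    case (Suc j)
    then have IH: "vs.independent (g ` {..<j})" "card (g ` {..<j}) = j" "g ` {..<j} \<subseteq> W j" by auto
    have "vs.span (g ` {..<j}) \<subseteq> W j"
      using IH(3) W[of j] Suc.prems by (intro vs.span_minimal) auto
    then have notin: "g j \<notin> vs.span (g ` {..<j})" using g(3)[of j] Suc.prems by auto
    then have notin': "g j \<notin> g ` {..<j}" by (rule contrapos_nn) (rule vs.span_base)
    have "W j \<subseteq> W (Suc j)" using chain[of j] Suc.prems by (auto simp: W_def)
    then have "g ` {..<Suc j} \<subseteq> W (Suc j)"
      using IH(3) g(2)[of j] Suc.prems by (simp add: lessThan_Suc)
    moreover have "vs.independent (g ` {..<Suc j})"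
      unfolding lessThan_Suc image_insert using vs.independent_insertI[OF notin IH(1)] .
    moreover have "card (g ` {..<Suc j}) = Suc j"
      unfolding lessThan_Suc image_insert using notin' IH(2) by simp
    ultimately show ?case by blast
  qed
  from this[of n] have "vs.independent (g ` {..<n})" "card (g ` {..<n}) = n" by simp_all
  moreover have "g ` {..<n} \<subseteq> vs.span T" using g(1) by (simp add: image_subset_iff)
  ultimately show "enat n \<le> enat (card T)"
    using vs.independent_span_bound[OF T(1), of "g ` {..<n}"] by simp
qed

lemma ring_length_quot_finite:
  assumes I: "ideal I (conv_ring {..<n})" and powers: "\<And>i. i < n \<Longrightarrow> mvar i ^ (k i + 1) \<in> I"
  shows "ring_length (conv_ring {..<n} Quot I) < \<infinity>"
proof -
  let ?B = "{A. A \<subseteq># box_top n k}"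
  have inj: "inj_on (mmonom :: _ \<Rightarrow> complex mfps) ?B"
    by (rule inj_onI) (metis mcoeff_mmonom zero_neq_one)
  have "ring_length (conv_ring {..<n} Quot I) \<le> enat (card (mmonom ` ?B :: complex mfps set))"
  proof (rule ring_length_quot_le_card[OF I])
    have "set_mset A \<subseteq> {..<n}" if "A \<subseteq># box_top n k" for A
      using set_mset_mono[OF that] count_box_top[of n k]
      by (auto simp flip: count_greater_zero_iff split: if_splits)
    then show "mmonom ` ?B \<subseteq> conv_series {..<n}" by (auto intro: mmonom_in_conv)
    fix h assume h: "h \<in> conv_series {..<n}"
    show "\<exists>c. h - (\<Sum>t\<in>mmonom ` ?B. mconst (c t) * t) \<in> I"
      using box_reduction[OF I powers h] inj
      by (intro exI[of _ "\<lambda>t. mcoeff h (inv_into ?B mmonom t)"]) (simp add: sum.reindex)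
  qed simp
  then show ?thesis by (metis enat_ord_simps(4) order_le_less_trans enat.distinct(2))
qed

text \<open>\<open>a - b\<close> divides \<open>a ^ n - b ^ n\<close>. The factor \<open>h\<close>
  is carried along because in the regularity proof only a multiple of \<open>q i\<close> is known to
  lie in the ideal.\<close>

lemma conv_ideal_power_cong:
  assumes I: "ideal I (conv_ring V)" and "a \<in> conv_series V" "b \<in> conv_series V"
    and ab: "(a - b) * h \<in> I"
  shows "(a ^ n - b ^ n) * h \<in> I"
proof -
  have "(\<Sum>i<n. b ^ (n - Suc i) * a ^ i) * ((a - b) * h) \<in> I"
    using assms by (intro conv_ideal_mult[OF I ab] conv_intros)
  then show ?thesis by (simp add: power_diff_sumr2 mult_ac)
qed

text \<open>Each coefficient is split into a multiple of \<open>mvar i\<close> and a part free of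
  it. The free parts combine to a series \<open>s\<close> without \<open>mvar i\<close>, as the
  \<open>q j\<close> do not involve it; but \<open>s\<close> is also a multiple of
  \<open>mvar i\<close>, hence zero.\<close>

lemma mvar_nonzerodivisor_mod:
  fixes n :: nat
  assumes q: "\<And>j. j < n \<Longrightarrow> q j \<in> conv_series V" "\<And>j. j < n \<Longrightarrow> supported (- {i}) (q j)"
    and mem: "mvar i * h \<in> Idl\<^bsub>conv_ring V\<^esub> (q ` {..<n})"
  shows "h \<in> Idl\<^bsub>conv_ring V\<^esub> (q ` {..<n})"
proof -
  let ?P = "\<lambda>A. i \<in># A"
  obtain c where c: "\<forall>j<n. c j \<in> conv_series V" and eq: "mvar i * h = (\<Sum>j<n. c j * q j)"
    using mem genideal_conv_ring[of n q V, OF q(1)] by auto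
  have "\<exists>g. g \<in> conv_series V \<and> restrict_series ?P (c j) = mvar i * g" if j: "j < n" for j
  proof -
    obtain g where "g \<in> conv_series V" "restrict_series ?P (c j) = mmonom {#i#} * g"
    proof (rule conv_series_mmonom_dvd)
      show "restrict_series ?P (c j) \<in> conv_series V" using c j by (simp add: restrict_in_conv)
    qed (auto split: if_splits)
    then show ?thesis by (auto simp: mvar_eq_mmonom)
  qed
  then obtain g where g: "\<And>j. j < n \<Longrightarrow> g j \<in> conv_series V"
    "\<And>j. j < n \<Longrightarrow> restrict_series ?P (c j) = mvar i * g j" by metis
  define s where "s = (\<Sum>j<n. restrict_series (\<lambda>A. \<not> ?P A) (c j) * q j)"
  have "(\<Sum>j<n. c j * q j) = (\<Sum>j<n. (mvar i * g j + restrict_series (\<lambda>A. \<not> ?P A) (c j)) * q j)"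
    by (rule sum.cong) (simp_all flip: g(2) restrict_series_split)
  also have "\<dots> = mvar i * (\<Sum>j<n. g j * q j) + s"
    by (simp add: s_def distrib_right sum.distrib sum_distrib_left mult.assoc)
  finally have s_eq: "s = mmonom {#i#} * (h - (\<Sum>j<n. g j * q j))"
    using eq by (simp add: right_diff_distrib mvar_eq_mmonom)
  have "supported (- {i}) s"
    unfolding s_def
    by (intro supported_sum supported_mult q(2)) (auto simp: supported_def split: if_splits)
  then have "mcoeff s A = 0" if "i \<in># A" for A
    using that unfolding supported_def by blast
  moreover have "mcoeff s A = 0" if "i \<notin># A" for A
    unfolding s_eq mcoeff_mmonom_mult using that by simp
  ultimately have "mcoeff s A = 0" for A by blast
  then have "mmonom {#i#} * (h - (\<Sum>j<n. g j * q j)) = mmonom {#i#} * 0"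
    unfolding s_eq[symmetric] by (intro mfps_eqI) simp
  then have "h = (\<Sum>j<n. g j * q j)" using mmonom_mult_cancel by fastforce
  then show ?thesis using g(1) genideal_conv_ring[of n q V, OF q(1)] by auto
qed

lemma mvar_power_nonzerodivisor_mod:
  fixes n :: nat
  assumes "\<And>j. j < n \<Longrightarrow> q j \<in> conv_series V" "\<And>j. j < n \<Longrightarrow> supported (- {i}) (q j)"
    and "mvar i ^ p * h \<in> Idl\<^bsub>conv_ring V\<^esub> (q ` {..<n})"
  shows "h \<in> Idl\<^bsub>conv_ring V\<^esub> (q ` {..<n})"
  using assms(3)
proof (induction p)
  case (Suc p)
  have "mvar i ^ p * h \<in> Idl\<^bsub>conv_ring V\<^esub> (q ` {..<n})"
    by (rule mvar_nonzerodivisor_mod[where i = i]) (use assms(1,2) Suc.prems in \<open>simp_all add: mult.assoc\<close>)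
  then show ?case by (rule Suc.IH)
qed simp

section \<open>Evaluation, derivatives and normal initial forms\<close>

text \<open>\<open>meval\<close> is an infinite sum, additive only where both sums exist; for
  polynomials, such as the components of the germ, this holds at every point.\<close>

definition finsupp :: "'a::comm_ring_1 mfps \<Rightarrow> bool"
  where "finsupp f \<longleftrightarrow> finite {A. mcoeff f A \<noteq> 0}"

lemma finsupp_mmonom: "finsupp (mmonom C)"
  unfolding finsupp_def by (rule finite_subset[of _ "{C}"]) (auto simp: mcoeff_mmonom)

lemma finsupp_add: "finsupp f \<Longrightarrow> finsupp g \<Longrightarrow> finsupp (f + g)"
  unfolding finsupp_def
  by (rule finite_subset[of _ "{A. mcoeff f A \<noteq> 0} \<union> {A. mcoeff g A \<noteq> 0}"]) auto

lemma finsupp_diff: "finsupp f \<Longrightarrow> finsupp g \<Longrightarrow> finsupp (f - g)"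
  unfolding finsupp_def
  by (rule finite_subset[of _ "{A. mcoeff f A \<noteq> 0} \<union> {A. mcoeff g A \<noteq> 0}"]) auto

lemma finsupp_summable:
  fixes x :: "nat \<Rightarrow> complex"
  assumes "finsupp f"
  shows "(\<lambda>A. mcoeff f A * (\<Prod>i\<in>#A. x i)) summable_on UNIV"
proof (rule finite_nonzero_values_imp_summable_on)
  show "finite {A \<in> UNIV. mcoeff f A * (\<Prod>i\<in>#A. x i) \<noteq> 0}"
    using assms unfolding finsupp_def by (rule rev_finite_subset) auto
qed

lemma meval_add: "finsupp f \<Longrightarrow> finsupp g \<Longrightarrow> meval (f + g) x = meval f x + meval g x"
  unfolding meval_def by (simp add: distrib_right infsum_add finsupp_summable)

lemma meval_diff: "finsupp f \<Longrightarrow> finsupp g \<Longrightarrow> meval (f - g) x = meval f x - meval g x"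
  using meval_add[of "f - g" g x] finsupp_diff[of f g] by simp

lemma meval_mmonom: "meval (mmonom C) x = (\<Prod>i\<in>#C. x i)"
proof -
  have "meval (mmonom C) x = (\<Sum>\<^sub>\<infinity>A\<in>{C}. \<Prod>i\<in>#A. x i)"
    unfolding meval_def by (rule infsum_cong_neutral) (auto simp: mcoeff_mmonom)
  then show ?thesis by simp
qed

lemma meval_origin: "meval f (\<lambda>_. 0) = mcoeff f {#}"
proof -
  have "meval f (\<lambda>_. 0) = (\<Sum>\<^sub>\<infinity>A\<in>{{#}}. mcoeff f A)"
    unfolding meval_def by (rule infsum_cong_neutral) auto
  then show ?thesis by simp
qed

lemma mcoeff_of_nat_mult: "mcoeff (of_nat n * f) A = of_nat n * mcoeff f A"
  by (induction n) (simp_all add: distrib_right)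

lemma mderiv_diff: "mderiv i (f - g) = mderiv i f - mderiv i g"
  by (rule mfps_eqI) (simp add: mderiv_def right_diff_distrib)

lemma mderiv_mmonom: "mderiv i (mmonom C) = of_nat (count C i) * mmonom (C - {#i#})"
proof (rule mfps_eqI)
  fix A
  show "mcoeff (mderiv i (mmonom C)) A = mcoeff (of_nat (count C i) * mmonom (C - {#i#}) :: 'a mfps) A"
  proof (cases "i \<in># C")
    case True
    then obtain B where "C = add_mset i B" by (metis mset_add)
    then show ?thesis by (auto simp: mderiv_def mcoeff_mmonom mcoeff_of_nat_mult simp del: of_nat_Suc)
  next
    case False
    then have "add_mset i A \<noteq> C" by auto
    with False show ?thesis by (simp add: mderiv_def mcoeff_mmonom mcoeff_of_nat_mult not_in_iff)
  qed
qed

lemma mderiv_one: "mderiv i 1 = 0"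
  by (simp add: one_eq_mmonom mderiv_mmonom)

lemma mderiv_mvar_power: "mderiv i (mvar j ^ n) = (if i = j then of_nat n * mvar j ^ (n - 1) else 0)"
  by (cases n) (auto simp: mvar_power mderiv_mmonom mderiv_one simp del: power_Suc)

lemma mderiv_mvar: "mderiv i (mvar j) = (if i = j then 1 else 0)"
  by (simp add: mvar_eq_mmonom mderiv_mmonom flip: one_eq_mmonom)

text \<open>The derivation z d/dz dual to the frame element dz/z is diagonal on monomials.\<close>

lemma mvar_mderiv_mmonom: "mvar i * mderiv i (mmonom C) = of_nat (count C i) * mmonom C"
proof (cases "i \<in># C")
  case True
  then have "mvar i * mmonom (C - {#i#}) = mmonom C"
    by (simp add: mvar_eq_mmonom mmonom_mult)
  then show ?thesis unfolding mderiv_mmonom by (metis mult.left_commute)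
qed (simp add: mderiv_mmonom not_in_iff)

lemma normal_mmonom: "normal_order (mmonom C :: 'a::comm_ring_1 mfps) = count C 0"
  "normal_initial (mmonom C :: 'a mfps) = mmonom C"
proof -
  show order: "normal_order (mmonom C :: 'a mfps) = count C 0"
    unfolding normal_order_def by (rule Least_equality) (auto simp: mcoeff_mmonom split: if_splits)
  show "normal_initial (mmonom C :: 'a mfps) = mmonom C"
    by (rule mfps_eqI) (simp add: normal_initial_def order mcoeff_mmonom)
qed

lemma normal_initial_order_0:
  assumes "mcoeff h A \<noteq> 0" "count A 0 = 0"
  shows "normal_initial h = restrict_series (\<lambda>A. count A 0 = 0) h"
proof -
  have "normal_order h = 0"
    unfolding normal_order_def using assms by (intro Least_eq_0) blast
  then show ?thesis by (simp add: normal_initial_def restrict_series_def)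
qed

section \<open>Nearly triangular determinants\<close>

text \<open>Laplace expansion along row 0, which has two entries; both minors are lower triangular.
  This is the shape of 1 - J: da/a involves only z and y_1, and each y_j is coupled only to its
  predecessor.\<close>

lemma det_lower_bidiagonal_corner:
  fixes H :: "'a::comm_ring_1 mat"
  assumes H: "H \<in> carrier_mat (Suc (Suc n)) (Suc (Suc n))"
    and upper: "\<And>i j. 0 < i \<Longrightarrow> i < j \<Longrightarrow> j < Suc (Suc n) \<Longrightarrow> H $$ (i, j) = 0"
    and top: "\<And>j. 1 < j \<Longrightarrow> j < Suc (Suc n) \<Longrightarrow> H $$ (0, j) = 0"
    and left: "\<And>i. 1 < i \<Longrightarrow> i < Suc (Suc n) \<Longrightarrow> H $$ (i, 0) = 0"
  shows "det H = H $$ (0, 0) * (\<Prod>i<Suc n. H $$ (Suc i, Suc i))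
    - H $$ (0, 1) * H $$ (1, 0) * (\<Prod>i<n. H $$ (i + 2, i + 2))"
proof -
  have md: "mat_delete H 0 j \<in> carrier_mat (Suc n) (Suc n)" if "j < Suc (Suc n)" for j
    using H that by (simp add: mat_delete_def)
  have "det (mat_delete H 0 0) = (\<Prod>i<Suc n. H $$ (Suc i, Suc i))"
  proof (subst det_lower_triangular[OF _ md])
    show "mat_delete H 0 0 $$ (i, j) = 0" if "i < j" "j < Suc n" for i j
      using H that by (simp add: mat_delete_def upper)
    show "prod_list (diag_mat (mat_delete H 0 0)) = (\<Prod>i<Suc n. H $$ (Suc i, Suc i))"
      unfolding prod_list_diag_prod lessThan_atLeast0
      by (rule prod.cong) (use H in \<open>auto simp: mat_delete_def\<close>)
  qed simp
  moreover have "det (mat_delete H 0 1) = H $$ (1, 0) * (\<Prod>i<n. H $$ (i + 2, i + 2))"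
  proof (subst det_lower_triangular[OF _ md])
    show "mat_delete H 0 1 $$ (i, j) = 0" if "i < j" "j < Suc n" for i j
      using H that by (simp add: mat_delete_def upper)
    have "prod_list (diag_mat (mat_delete H 0 1)) = (\<Prod>i<Suc n. mat_delete H 0 1 $$ (i, i))"
      unfolding prod_list_diag_prod lessThan_atLeast0
      by (rule prod.cong) (use H in \<open>auto simp: mat_delete_def\<close>)
    also have "\<dots> = mat_delete H 0 1 $$ (0, 0) * (\<Prod>i<n. mat_delete H 0 1 $$ (Suc i, Suc i))"
      by (rule prod.lessThan_Suc_shift)
    also have "\<dots> = H $$ (1, 0) * (\<Prod>i<n. H $$ (i + 2, i + 2))"
      using H by (auto simp: mat_delete_def intro!: arg_cong2[where f = "(*)"] prod.cong)
    finally show "prod_list (diag_mat (mat_delete H 0 1)) = H $$ (1, 0) * (\<Prod>i<n. H $$ (i + 2, i + 2))" .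
  qed simp
  moreover have "det H = (\<Sum>j<Suc (Suc n). H $$ (0, j) * cofactor H 0 j)"
    by (rule laplace_expansion_row[OF H]) simp
  moreover have "\<dots> = H $$ (0, 0) * cofactor H 0 0 + (H $$ (0, 1) * cofactor H 0 1
      + (\<Sum>j<n. H $$ (0, Suc (Suc j)) * cofactor H 0 (Suc (Suc j))))"
    by (simp only: sum.lessThan_Suc_shift One_nat_def)
  ultimately show ?thesis
    by (simp add: top cofactor_def mult.assoc)
qed

text \<open>Unrolling the recursion writes \<open>x i\<close> in terms of
  \<open>g 0, ..., g i\<close>; the coefficient of \<open>g j\<close> is \<open>S j\<close> times
  the factors \<open>s\<close> collected on the way from \<open>j\<close> to
  \<open>i\<close>.\<close>

lemma lower_triangular_rows:
  fixes S s g x :: "nat \<Rightarrow> 'a::comm_ring_1"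
  assumes base: "x 0 = S 0 * g 0"
    and step: "\<And>i. Suc i < n \<Longrightarrow> x (Suc i) = s (Suc i) * x i + S (Suc i) * g (Suc i)"
  defines "A \<equiv> mat n n (\<lambda>(i, j). if j \<le> i then S j * (\<Prod>l\<in>{j<..i}. s l) else 0)"
  shows "det A = (\<Prod>i<n. S i)" and "i < n \<Longrightarrow> (\<Sum>j<n. A $$ (i, j) * g j) = x i"
proof -
  show "det A = (\<Prod>i<n. S i)"
    by (subst det_lower_triangular[of n]) (auto simp: A_def prod_list_diag_prod lessThan_atLeast0)
  have partial: "(\<Sum>j\<le>i. S j * (\<Prod>l\<in>{j<..i}. s l) * g j) = x i" if "i < n" for i
    using that
  proof (induction i)
    case (Suc i)
    have "(\<Sum>j\<le>i. S j * (\<Prod>l\<in>{j<..Suc i}. s l) * g j) = (\<Sum>j\<le>i. s (Suc i) * (S j * (\<Prod>l\<in>{j<..i}. s l) * g j))"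
    proof (rule sum.cong)
      fix j assume "j \<in> {..i}"
      then have "{j<..Suc i} = insert (Suc i) {j<..i}" by auto
      then show "S j * (\<Prod>l\<in>{j<..Suc i}. s l) * g j = s (Suc i) * (S j * (\<Prod>l\<in>{j<..i}. s l) * g j)"
        by (simp add: mult_ac)
    qed simp
    also have "\<dots> = s (Suc i) * x i" using Suc by (simp add: sum_distrib_left[symmetric])
    finally show ?case using step[OF Suc.prems] by simp
  qed (simp add: base)
  assume i: "i < n"
  have "(\<Sum>j<n. A $$ (i, j) * g j) = (\<Sum>j\<le>i. A $$ (i, j) * g j)"
    using i by (intro sum.mono_neutral_right) (auto simp: A_def)
  also have "\<dots> = (\<Sum>j\<le>i. S j * (\<Prod>l\<in>{j<..i}. s l) * g j)"
    using i by (intro sum.cong) (auto simp: A_def)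
  finally show "(\<Sum>j<n. A $$ (i, j) * g j) = x i" using partial[OF i] by simp
qed

section \<open>The tower of fixed-point equations\<close>

locale tower =
  fixes m r :: nat and d :: "nat \<Rightarrow> nat" and f q :: "nat \<Rightarrow> complex mfps"
  assumes m: "m \<ge> 1" and r: "r \<ge> 1"
    and d: "\<And>j. 1 \<le> j \<Longrightarrow> j \<le> m \<Longrightarrow> d j \<ge> 2"
    and f_0: "f 0 = mvar 0 - mvar 0 ^ (r + 1) * (1 + mvar 1)"
    and f_1: "f 1 = mvar 1 - mvar 1 ^ d 1 - mvar 0"
    and f_j: "\<And>j. 2 \<le> j \<Longrightarrow> j \<le> m \<Longrightarrow> f j = mvar j - mvar j ^ d j - mvar (j - 1)"
    and q_0: "q 0 = mvar 0 ^ (r + 1)"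
    and q_1: "q 1 = mvar 1 ^ d 1 + mvar 0"
    and q_j: "\<And>j. 2 \<le> j \<Longrightarrow> j \<le> m \<Longrightarrow> q j = mvar j ^ d j + mvar (j - 1)"
begin

definition N :: "nat \<Rightarrow> nat" where "N i = (r + 1) * (\<Prod>j=1..i. d j)"

text \<open>The residue writes its powers as \<open>mvar i ^ (k i + 1)\<close>, so \<open>k\<close>
  is the exponent vector of the corner monomial.\<close>

definition k :: "nat \<Rightarrow> nat" where "k i = N i - 1"

lemma N_0: "N 0 = r + 1" and N_Suc: "N (Suc i) = N i * d (Suc i)"
  by (simp_all add: N_def algebra_simps)

lemma k_0: "k 0 = r"
  by (simp add: k_def N_0)

lemma N_pos: "i \<le> m \<Longrightarrow> 0 < N i"
proof (induction i)
  case (Suc i)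
  then show ?case using d[of "Suc i"] by (simp add: N_Suc)
qed (simp add: N_0)

lemma N_eq_k: "i \<le> m \<Longrightarrow> N i = k i + 1"
  using N_pos[of i] by (simp add: k_def)

text \<open>Splits the corner power of the next variable into the \<open>k i\<close>-th power of
  \<open>mvar (Suc i) ^ d (Suc i)\<close> and the factor that comes from the derivative of
  \<open>mvar (Suc i) ^ d (Suc i)\<close>.\<close>

lemma k_Suc: "i < m \<Longrightarrow> k (Suc i) = d (Suc i) * k i + (d (Suc i) - 1)"
  using N_eq_k[of i] N_eq_k[of "Suc i"] d[of "Suc i"] by (simp add: N_Suc algebra_simps)

lemma q_Suc: "j < m \<Longrightarrow> q (Suc j) = mvar (Suc j) ^ d (Suc j) + mvar j"
  using q_1 q_j[of "Suc j"] by (cases j) simp_all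

lemma f_Suc: "j < m \<Longrightarrow> f (Suc j) = mvar (Suc j) - mvar (Suc j) ^ d (Suc j) - mvar j"
  using f_1 f_j[of "Suc j"] by (cases j) simp_all

lemma mvar_conv: "i \<le> m \<Longrightarrow> mvar i \<in> conv_series {..m}"
  by (simp add: mvar_in_conv)

lemma q_conv: "i \<le> m \<Longrightarrow> q i \<in> conv_series {..m}"
  by (cases i) (auto simp: q_0 q_Suc simp del: power_Suc intro!: conv_intros)

lemma f_conv: "i \<le> m \<Longrightarrow> f i \<in> conv_series {..m}"
  using m by (cases i) (auto simp: f_0 f_Suc simp del: power_Suc intro!: conv_intros)

lemma denominator_0: "mvar 0 - f 0 = (1 + mvar 1) * q 0"
  by (simp add: f_0 q_0 mult.commute)

lemma denominator_Suc: "j < m \<Longrightarrow> mvar (Suc j) - f (Suc j) = q (Suc j)"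
  by (simp add: f_Suc q_Suc)

lemma unit_inverse: "\<exists>u\<in>conv_series {..m}. (1 + mvar 1) * u = 1"
proof -
  have "- mvar 1 \<in> conv_series {..m}" using m by (intro conv_intros) simp
  moreover have "mcoeff (- mvar 1 :: complex mfps) {#} = 0" by (simp add: mvar_eq_mmonom mcoeff_mmonom)
  ultimately obtain b where "b \<in> conv_series {..m}" "(1 - - mvar 1) * b = 1"
    by (rule conv_series_inverse)
  then show ?thesis by auto
qed

lemma unit_Units: "1 + mvar 1 \<in> Units (germ_ring m)"
  using unit_inverse m by (auto simp: Units_def mult.commute intro!: conv_intros bexI)

definition I where "I = Idl\<^bsub>germ_ring m\<^esub> (q ` {..<Suc m})"

lemma I_ideal: "ideal I (germ_ring m)"
  unfolding I_def by (rule genideal_conv_ring_ideal) (simp add: q_conv)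

lemma I_generator: "i \<le> m \<Longrightarrow> q i \<in> I"
  unfolding I_def by (rule genideal_conv_ring_generator) (simp_all add: q_conv)

lemma fixed_ideal_eq: "fixed_ideal m f = I"
proof
  let ?g = "\<lambda>i. mvar i - f i"
  have g: "?g i \<in> conv_series {..m}" if "i < Suc m" for i
    using that by (auto intro!: conv_intros f_conv)
  have fi: "fixed_ideal m f = Idl\<^bsub>germ_ring m\<^esub> (?g ` {..<Suc m})"
    by (simp add: fixed_ideal_def lessThan_Suc_atMost)
  have u: "1 + mvar 1 \<in> conv_series {..m}" using m by (auto intro!: conv_intros)
  have "?g i \<in> I" if "i < Suc m" for i
    using that by (cases i)
      (simp_all add: denominator_0 denominator_Suc I_generator conv_ideal_mult[OF I_ideal _ u] del: One_nat_def)
  then show "fixed_ideal m f \<subseteq> I"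
    unfolding fi by (intro ring.genideal_minimal[OF conv_ring_ring I_ideal]) auto
  have ideal: "ideal (fixed_ideal m f) (germ_ring m)"
    unfolding fi by (rule genideal_conv_ring_ideal) (rule g)
  have gen: "?g i \<in> fixed_ideal m f" if "i \<le> m" for i
    unfolding fi using that by (intro genideal_conv_ring_generator g) simp_all
  obtain u' where u': "u' \<in> conv_series {..m}" "(1 + mvar 1) * u' = 1" using unit_inverse by blast
  have "q i \<in> fixed_ideal m f" if "i \<le> m" for i
  proof (cases i)
    case 0
    have "u' * ((1 + mvar 1) * q 0) \<in> fixed_ideal m f"
      using conv_ideal_mult[OF ideal gen[of 0] u'(1)] denominator_0 by simp
    also have "u' * ((1 + mvar 1) * q 0) = ((1 + mvar 1) * u') * q 0" by (simp only: mult_ac)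
    finally show ?thesis using u'(2) 0 by simp
  next
    case (Suc j)
    then show ?thesis using gen[OF that] that denominator_Suc[of j] by simp
  qed
  then show "I \<subseteq> fixed_ideal m f"
    unfolding I_def by (intro ring.genideal_minimal[OF conv_ring_ring ideal]) auto
qed

lemma one_notin_I: "1 \<notin> I"
proof
  assume "1 \<in> I"
  then obtain c where c: "1 = (\<Sum>j<Suc m. c j * q j)"
    unfolding I_def using genideal_conv_ring[of "Suc m" q "{..m}"] q_conv by auto
  have "mcoeff (q j) {#} = 0" if "j < Suc m" for j
    using that d[of j] by (cases j) (auto simp: q_0 q_Suc mcoeff_mvar_power_empty mcoeff_mvar_power_empty[of 1, simplified]
      simp del: power_Suc)
  then have "mcoeff (\<Sum>j<Suc m. c j * q j) {#} = 0"
    unfolding mcoeff_sum by (intro sum.neutral) (simp add: mcoeff_mult_empty)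
  then show False using c by (metis mcoeff_one zero_neq_one)
qed

text \<open>Stated for any ideal containing \<open>q 0, ..., q i\<close>, so that it serves both
  \<open>I\<close> and the ideals of initial segments in the regularity proof.\<close>

lemma mvar_power_in_ideal:
  assumes J: "ideal J (germ_ring m)" and "i \<le> m" "\<And>j. j \<le> i \<Longrightarrow> q j \<in> J"
  shows "mvar i ^ N i \<in> J"
  using assms(2,3)
proof (induction i)
  case 0
  then show ?case using q_0 by (simp add: N_0)
next
  case (Suc i)
  let ?x = "mvar (Suc i) ^ d (Suc i)" and ?y = "mvar i"
  have conv: "?x \<in> conv_series {..m}" "- ?y \<in> conv_series {..m}" "(- 1) ^ N i \<in> conv_series {..m}"
    using Suc.prems by (auto intro!: conv_intros)
  have "(?x - - ?y) * 1 \<in> J"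
    using Suc.prems(2)[of "Suc i"] q_Suc[of i] Suc.prems(1) by simp
  then have "(?x ^ N i - (- ?y) ^ N i) * 1 \<in> J"
    by (rule conv_ideal_power_cong[OF J conv(1,2)])
  moreover have "(- ?y) ^ N i \<in> J"
    using conv_ideal_mult[OF J Suc.IH conv(3)] Suc.prems by (simp add: power_minus[of ?y])
  ultimately have "(?x ^ N i - (- ?y) ^ N i) * 1 + (- ?y) ^ N i \<in> J"
    by (rule conv_ideal_add[OF J])
  then show ?case by (simp add: N_Suc power_mult[symmetric] mult.commute)
qed

lemma mvar_power_in_I: "i \<le> m \<Longrightarrow> mvar i ^ N i \<in> I"
  by (intro mvar_power_in_ideal I_ideal I_generator) auto

text \<open>Let \<open>q i * h\<close> lie in the ideal of the earlier \<open>q j\<close>. The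
  previous variable is nilpotent modulo that ideal, so a power of \<open>mvar i\<close> times
  \<open>h\<close> lies in it. The earlier \<open>q j\<close> do not involve \<open>mvar i\<close>,
  so this power can be cancelled.\<close>

lemma regular: "regular_sequence (germ_ring m) m q"
  unfolding regular_sequence_def
proof (intro conjI allI impI ballI)
  show "q i \<in> carrier (germ_ring m)" if "i \<le> m" for i using q_conv[OF that] by simp
  show "Idl\<^bsub>germ_ring m\<^esub> (q ` {..m}) \<noteq> carrier (germ_ring m)"
    using one_notin_I one_in_conv unfolding I_def lessThan_Suc_atMost by auto
  fix i h assume i: "i \<le> m" and "h \<in> carrier (germ_ring m)"
    and "q i \<otimes>\<^bsub>germ_ring m\<^esub> h \<in> Idl\<^bsub>germ_ring m\<^esub> (q ` {..<i})"
  then have h: "h \<in> conv_series {..m}" and qh: "q i * h \<in> Idl\<^bsub>germ_ring m\<^esub> (q ` {..<i})" by simp_all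
  have q: "q j \<in> conv_series {..m}" if "j < i" for j using that i q_conv by simp
  have J: "ideal (Idl\<^bsub>germ_ring m\<^esub> (q ` {..<i})) (germ_ring m)"
    by (rule genideal_conv_ring_ideal) (rule q)
  show "h \<in> Idl\<^bsub>germ_ring m\<^esub> (q ` {..<i})"
  proof (cases i)
    case 0
    have "mmonom (replicate_mset (r + 1) 0) * h = mmonom (replicate_mset (r + 1) 0) * 0"
      using qh genideal_conv_ring[of 0 q "{..m}"] by (simp add: 0 q_0 mvar_power del: power_Suc replicate_mset_Suc)
    then have "h = 0" by (rule mmonom_mult_cancel)
    then show ?thesis using conv_ideal_zero[OF J] by simp
  next
    case (Suc j)
    let ?J = "Idl\<^bsub>germ_ring m\<^esub> (q ` {..<i})"
    let ?x = "mvar i ^ d i" and ?y = "mvar j"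
    have conv: "?x \<in> conv_series {..m}" "- ?y \<in> conv_series {..m}" "(- 1) ^ N j * h \<in> conv_series {..m}"
      using i Suc h by (auto intro!: conv_intros)
    have "mvar j ^ N j \<in> ?J"
      by (rule mvar_power_in_ideal[OF J]) (use i Suc in \<open>auto intro!: genideal_conv_ring_generator q\<close>)
    then have "((- 1) ^ N j * h) * ?y ^ N j \<in> ?J"
      by (rule conv_ideal_mult[OF J _ conv(3)])
    also have "((- 1) ^ N j * h) * ?y ^ N j = (- ?y) ^ N j * h"
      by (simp add: power_minus[of ?y] mult_ac)
    finally have "(- ?y) ^ N j * h \<in> ?J" .
    moreover have "(?x - - ?y) * h \<in> ?J"
      using qh q_Suc[of j] i Suc by simp
    then have "(?x ^ N j - (- ?y) ^ N j) * h \<in> ?J"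
      by (rule conv_ideal_power_cong[OF J conv(1,2)])
    ultimately have "(?x ^ N j - (- ?y) ^ N j) * h + (- ?y) ^ N j * h \<in> ?J"
      by (intro conv_ideal_add[OF J])
    then have "mvar i ^ (d i * N j) * h \<in> ?J"
      by (simp add: left_diff_distrib power_mult)
    then show ?thesis
    proof (rule mvar_power_nonzerodivisor_mod[rotated 2])
      show "supported (- {i}) (q l)" if "l < i" for l
        using that i
        by (cases l) (auto simp: q_0 q_Suc simp del: power_Suc
          intro!: supported_add supported_mvar supported_mvar_power)
    qed (rule q)
  qed
qed

section \<open>The residue\<close>

text \<open>The cofactor in x^n - y^n = (x - y) T for x = \<open>mvar (Suc i) ^ d (Suc i)\<close>, y
  = \<open>- mvar i\<close> and n = \<open>N i\<close>; here x - y is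
  \<open>q (Suc i)\<close>.\<close>

definition T :: "nat \<Rightarrow> complex mfps" where
  "T i = (\<Sum>t<N i. (- mvar i) ^ (N i - Suc t) * (mvar (Suc i) ^ d (Suc i)) ^ t)"

text \<open>The part of det (1 - J) that the residue detects, stripped of its constant and its
  units.\<close>

definition top_product :: "complex mfps" where
  "top_product = mvar 0 ^ r * (\<Prod>i<m. mvar (Suc i) ^ (d (Suc i) - 1))"

lemma T_conv: "i < m \<Longrightarrow> T i \<in> conv_series {..m}"
  unfolding T_def by (intro conv_intros) auto

lemma residue_matrix:
  "\<exists>A u. A \<in> carrier_mat (Suc m) (Suc m) \<and>
    (\<forall>i\<le>m. \<forall>j\<le>m. A $$ (i, j) \<in> conv_series {..m}) \<and>
    (\<forall>i\<le>m. (\<Sum>j<Suc m. A $$ (i, j) * (mvar j - f j)) = mvar i ^ (k i + 1)) \<and>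
    (1 + mvar 1) * u = 1 \<and> det A = u * (\<Prod>i<m. T i)"
proof -
  obtain u where u: "u \<in> conv_series {..m}" "(1 + mvar 1) * u = 1" using unit_inverse by blast
  \<comment> \<open>The first denominator is \<open>1 + mvar 1\<close> times
    \<open>mvar 0 ^ (r + 1)\<close>, so its multiplier is the inverse unit \<open>u\<close>; the
    later ones use the cofactors \<open>T i\<close>.\<close>
  define S where "S = (\<lambda>i. case i of 0 \<Rightarrow> u | Suc i \<Rightarrow> T i)"
  \<comment> \<open>The sign in \<open>(- mvar i) ^ N i = (- 1) ^ N i * mvar i ^ N i\<close>; it
    belongs to row \<open>Suc i\<close>, hence the shifted index.\<close>
  define s :: "nat \<Rightarrow> complex mfps" where "s = (\<lambda>i. (- 1) ^ N (i - 1))"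
  let ?g = "\<lambda>i. mvar i - f i"
  define A where "A = mat (Suc m) (Suc m) (\<lambda>(i, j). if j \<le> i then S j * (\<Prod>l\<in>{j<..i}. s l) else 0)"
  have base: "mvar 0 ^ N 0 = S 0 * ?g 0"
  proof -
    have "S 0 * ?g 0 = ((1 + mvar 1) * u) * mvar 0 ^ N 0"
      unfolding denominator_0 q_0 N_0 S_def by (simp only: mult_ac nat.case)
    then show ?thesis using u(2) by simp
  qed
  have step: "mvar (Suc i) ^ N (Suc i) = s (Suc i) * mvar i ^ N i + S (Suc i) * ?g (Suc i)"
    if "Suc i < Suc m" for i
  proof -
    have "(mvar (Suc i) ^ d (Suc i)) ^ N i - (- mvar i) ^ N i = ?g (Suc i) * T i"
      unfolding T_def power_diff_sumr2 using that by (simp add: denominator_Suc q_Suc)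
    then have "(mvar (Suc i) ^ d (Suc i)) ^ N i = (- 1) ^ N i * mvar i ^ N i + T i * ?g (Suc i)"
      by (simp add: power_minus[of "mvar i"] algebra_simps)
    then show ?thesis by (simp add: N_Suc S_def s_def power_mult mult.commute[of "N i"])
  qed
  note rows = lower_triangular_rows[of "\<lambda>i. mvar i ^ N i" S ?g "Suc m" s, OF base step, folded A_def]
  show ?thesis
  proof (intro exI conjI allI impI)
    show "A \<in> carrier_mat (Suc m) (Suc m)" by (simp add: A_def)
    have "S i \<in> conv_series {..m}" if "i \<le> m" for i
      using that u(1) T_conv by (cases i) (auto simp: S_def)
    then show "A $$ (i, j) \<in> conv_series {..m}" if "i \<le> m" "j \<le> m" for i j
      using that by (auto simp: A_def s_def intro!: conv_intros)
    show "(\<Sum>j<Suc m. A $$ (i, j) * ?g j) = mvar i ^ (k i + 1)" if "i \<le> m" for i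
      using rows(2)[of i] that by (simp only: N_eq_k less_Suc_eq_le)
    show "(1 + mvar 1) * u = 1" by fact
    have "(\<Prod>i<Suc m. S i) = S 0 * (\<Prod>i<m. S (Suc i))" by (rule prod.lessThan_Suc_shift)
    then show "det A = u * (\<Prod>i<m. T i)" using rows(1) by (simp add: S_def)
  qed
qed

text \<open>Only the last summand of \<open>T i\<close>, at index \<open>k i\<close>, carries no
  factor \<open>mvar i\<close>.\<close>

lemma T_split:
  assumes "i \<le> m"
  obtains W where "T i = mvar (Suc i) ^ (d (Suc i) * k i) + mvar i * W"
proof
  have "T i = (\<Sum>t<k i. (- mvar i) ^ (Suc (k i) - Suc t) * (mvar (Suc i) ^ d (Suc i)) ^ t)
      + (mvar (Suc i) ^ d (Suc i)) ^ k i"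
    unfolding T_def N_eq_k[OF assms] by simp
  also have "(\<Sum>t<k i. (- mvar i) ^ (Suc (k i) - Suc t) * (mvar (Suc i) ^ d (Suc i)) ^ t :: complex mfps)
      = (\<Sum>t<k i. mvar i * (- ((- mvar i) ^ (k i - Suc t) * (mvar (Suc i) ^ d (Suc i)) ^ t)))"
  proof (rule sum.cong)
    fix t assume "t \<in> {..<k i}"
    then have "Suc (k i) - Suc t = Suc (k i - Suc t)" by auto
    then show "(- mvar i) ^ (Suc (k i) - Suc t) * (mvar (Suc i) ^ d (Suc i)) ^ t
        = mvar i * (- ((- mvar i) ^ (k i - Suc t) * (mvar (Suc i) ^ d (Suc i)) ^ t :: complex mfps))"
      by (simp add: mult_ac)
  qed simp
  finally show "T i = mvar (Suc i) ^ (d (Suc i) * k i) + mvar i *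
      (\<Sum>t<k i. - ((- mvar i) ^ (k i - Suc t) * (mvar (Suc i) ^ d (Suc i)) ^ t))"
    by (simp add: sum_distrib_left power_mult)
qed

text \<open>The factors enter one at a time. The accumulated monomial contains
  \<open>mvar t ^ k t\<close>, so the multiple of \<open>mvar t\<close> in \<open>T t\<close>
  produces \<open>mvar t ^ (k t + 1)\<close> and dies. The surviving summand completes the corner
  power of the next variable.\<close>

lemma killed_top_product:
  assumes "t \<le> m"
  shows "killed {..<Suc m} k (mvar 0 ^ r * (\<Prod>i<t. T i * mvar (Suc i) ^ (d (Suc i) - 1))
    - (\<Prod>i<Suc t. mvar i ^ k i))"
  using assms
proof (induction t)
  case 0
  show ?case by (simp add: k_0)
next
  case (Suc t)
  let ?P = "mvar 0 ^ r * (\<Prod>i<t. T i * mvar (Suc i) ^ (d (Suc i) - 1))"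
  let ?Q = "\<Prod>i<Suc t. mvar i ^ k i :: complex mfps"
  let ?e = "mvar (Suc t) ^ (d (Suc t) - 1) :: complex mfps"
  obtain W where W: "T t = mvar (Suc t) ^ (d (Suc t) * k t) + mvar t * W"
    using T_split[of t] Suc.prems by auto
  have "mvar (Suc t) ^ (d (Suc t) * k t) * ?e = mvar (Suc t) ^ k (Suc t)"
    using k_Suc[of t] Suc.prems by (simp add: power_add)
  then have Te: "T t * ?e = mvar (Suc t) ^ k (Suc t) + mvar t * W * ?e"
    by (simp add: W distrib_right)
  have "?P * (T t * ?e) - ?Q * mvar (Suc t) ^ k (Suc t)
      = (T t * ?e) * (?P - ?Q) + ?Q * (mvar t * W * ?e)"
    unfolding Te by (simp add: algebra_simps)
  also have "?Q * (mvar t * W * ?e) = ((\<Prod>i<t. mvar i ^ k i) * W * ?e) * mvar t ^ (k t + 1)"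
    by (simp add: mult_ac)
  finally have "?P * (T t * ?e) - ?Q * mvar (Suc t) ^ k (Suc t)
      = (T t * ?e) * (?P - ?Q) + ((\<Prod>i<t. mvar i ^ k i) * W * ?e) * mvar t ^ (k t + 1)" .
  moreover have "killed {..<Suc m} k (mvar t ^ (k t + 1) :: complex mfps)"
    using Suc.prems by (intro killed_mvar_power) auto
  ultimately have "killed {..<Suc m} k (?P * (T t * ?e) - ?Q * mvar (Suc t) ^ k (Suc t))"
    using Suc by (simp only:) (intro killed_add killed_mult; simp)
  then show ?case by (simp add: mult.assoc)
qed

lemma mcoeff_top_product: "mcoeff ((\<Prod>i<m. T i) * top_product) (box_top (Suc m) k) = 1"
proof -
  have "(\<Prod>i<m. T i) * top_product = mvar 0 ^ r * (\<Prod>i<m. T i * mvar (Suc i) ^ (d (Suc i) - 1))"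
    by (simp add: top_product_def prod.distrib mult_ac)
  moreover have "mcoeff (\<Prod>i<Suc m. mvar i ^ k i) (box_top (Suc m) k) = (1 :: complex)"
    unfolding prod_mvar_power by (simp add: mcoeff_mmonom)
  ultimately show ?thesis
    using mcoeff_box_top_killed[OF killed_top_product[of m]] by (simp del: prod.lessThan_Suc)
qed

lemma top_product_notin_I: "top_product \<notin> I"
proof
  assume "top_product \<in> I"
  from residue_matrix obtain A u where A: "A \<in> carrier_mat (Suc m) (Suc m)"
    and rows: "\<forall>i\<le>m. (\<Sum>j<Suc m. A $$ (i, j) * (mvar j - f j)) = mvar i ^ (k i + 1)"
    and u: "(1 + mvar 1) * u = 1" and det: "det A = u * (\<Prod>i<m. T i)"
    by (elim exE conjE) (rule that)
  \<comment> \<open>The unit is inserted to cancel the \<open>u\<close> in \<open>det A\<close>, so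
    that the residue becomes the coefficient 1 of \<open>mcoeff_top_product\<close>.\<close>
  have "(1 + mvar 1) * top_product \<in> I"
    using \<open>top_product \<in> I\<close> m by (intro conv_ideal_mult[OF I_ideal] conv_intros) auto
  then have "(1 + mvar 1) * top_product \<in> Idl\<^bsub>germ_ring m\<^esub> ((\<lambda>i. mvar i - f i) ` {..<Suc m})"
    unfolding fixed_ideal_eq[symmetric] fixed_ideal_def lessThan_Suc_atMost .
  moreover have "mvar i - f i \<in> conv_series {..m}" if "i < Suc m" for i
    using that by (auto intro!: conv_intros f_conv)
  ultimately obtain c where c: "(1 + mvar 1) * top_product = (\<Sum>j<Suc m. c j * (mvar j - f j))"
    using genideal_conv_ring[of "Suc m" "\<lambda>i. mvar i - f i" "{..m}"] by auto
  have "mcoeff (det A * ((1 + mvar 1) * top_product)) (box_top (Suc m) k) = 0"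
    unfolding c by (rule residue_coeff_combination[OF A]) (use rows in simp)
  also have "det A * ((1 + mvar 1) * top_product) = ((1 + mvar 1) * u) * ((\<Prod>i<m. T i) * top_product)"
    unfolding det by (simp only: mult_ac)
  finally show False using mcoeff_top_product u by simp
qed

text \<open>Modulo \<open>I\<close>, \<open>y\<^sub>m ^ k m\<close> equals \<open>top_product\<close> up to sign, because \<open>y\<^sub>t ^ d t\<close> equals \<open>- y\<^sub>t\<^sub>-\<^sub>1\<close>.\<close>

lemma mvar_power_k_notin_I: "mvar m ^ k m \<notin> I"
proof
  \<comment> \<open>Interpolates from \<open>E m = mvar m ^ k m\<close> down to
    \<open>E 0 = top_product\<close>; each step trades one power of the next variable for
    \<open>mvar t ^ k t\<close>.\<close>
  define E where "E = (\<lambda>t. mvar t ^ k t * (\<Prod>j\<in>{t..<m}. mvar (Suc j) ^ (d (Suc j) - 1)) :: complex mfps)"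
  assume "mvar m ^ k m \<in> I"
  then have "E m \<in> I" by (simp add: E_def)
  moreover have "E t \<in> I" if "E (Suc t) \<in> I" "t < m" for t
  proof -
    let ?x = "mvar (Suc t) ^ d (Suc t) :: complex mfps" and ?y = "mvar t :: complex mfps"
    define h :: "complex mfps" where
      "h = mvar (Suc t) ^ (d (Suc t) - 1) * (\<Prod>j\<in>{Suc t..<m}. mvar (Suc j) ^ (d (Suc j) - 1))"
    have conv: "?x \<in> conv_series {..m}" "- ?y \<in> conv_series {..m}" "h \<in> conv_series {..m}"
      "(- 1) ^ k t \<in> conv_series {..m}"
      using that unfolding h_def by (auto intro!: conv_intros)
    have Et: "E t = ?y ^ k t * h"
      unfolding E_def h_def using that(2) by (simp add: prod.atLeast_Suc_lessThan)
    have Es: "E (Suc t) = ?x ^ k t * h"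
      unfolding E_def h_def using that(2) by (simp add: k_Suc power_add power_mult mult.assoc)
    have "(?x - - ?y) * h \<in> I"
      using conv_ideal_mult[OF I_ideal I_generator[of "Suc t"] conv(3)] q_Suc[of t] that(2)
      by (simp add: mult.commute)
    then have "(?x ^ k t - (- ?y) ^ k t) * h \<in> I"
      by (rule conv_ideal_power_cong[OF I_ideal conv(1,2)])
    with that(1) have "?x ^ k t * h - (?x ^ k t - (- ?y) ^ k t) * h \<in> I"
      unfolding Es by (intro conv_ideal_diff[OF I_ideal])
    also have "?x ^ k t * h - (?x ^ k t - (- ?y) ^ k t) * h = (- ?y) ^ k t * h"
      by (simp add: algebra_simps)
    finally have "(- 1) ^ k t * ((- ?y) ^ k t * h) \<in> I"
      by (rule conv_ideal_mult[OF I_ideal _ conv(4)])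
    also have "(- 1) ^ k t * ((- ?y) ^ k t * h) = E t"
      unfolding Et mult.assoc[symmetric] power_mult_distrib[symmetric] by simp
    finally show ?thesis .
  qed
  ultimately have "E 0 \<in> I" by (intro inc_induct[of 0 m "\<lambda>t. E t \<in> I"]) auto
  moreover have "E 0 = top_product" by (simp add: E_def top_product_def k_0 lessThan_atLeast0)
  ultimately show False using top_product_notin_I by simp
qed

lemma mvar_power_in_I_iff: "mvar m ^ e \<in> I \<longleftrightarrow> N m \<le> e"
proof
  show "mvar m ^ e \<in> I" if "N m \<le> e"
    using conv_ideal_power_mono[OF I_ideal mvar_power_in_I that] mvar_conv by simp
  show "N m \<le> e" if "mvar m ^ e \<in> I"
  proof (rule ccontr)
    assume "\<not> N m \<le> e"
    then have "e \<le> k m" by (simp add: k_def)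
    then show False
      using conv_ideal_power_mono[OF I_ideal that _ mvar_conv] mvar_power_k_notin_I by blast
  qed
qed

section \<open>The normal factor, the logarithmic Jacobian and the index\<close>

definition a :: "complex mfps" where "a = 1 - mvar 0 ^ r * (1 + mvar 1)"

lemma a_conv: "a \<in> conv_series {..m}"
  unfolding a_def using m by (intro conv_intros) auto

lemma f_0_eq: "f 0 = mvar 0 * a"
  by (simp add: f_0 a_def algebra_simps)

lemma mcoeff_a: "mcoeff a {#} = 1"
  using r by (simp add: a_def mcoeff_mult_empty mcoeff_mvar_power_empty mcoeff_one)

lemma normal_factor_eq: "normal_factor m f = a"
  unfolding normal_factor_def
proof (rule the_equality)
  show "a \<in> carrier (germ_ring m) \<and> f 0 = mvar 0 * a" using a_conv f_0_eq by simp
  fix b assume "b \<in> carrier (germ_ring m) \<and> f 0 = mvar 0 * b"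
  then have "mmonom {#0#} * b = mmonom {#0#} * a" using f_0_eq by (simp add: mvar_eq_mmonom)
  then show "b = a" by (rule mmonom_mult_cancel)
qed

lemma resonant: "normally_resonant m f"
  unfolding normally_resonant_def using a_conv f_0_eq mcoeff_a
  by (intro bexI[of _ a]) (simp_all add: meval_origin)

definition b :: "complex mfps" where "b = inv\<^bsub>germ_ring m\<^esub> a"

lemma ab: "a * b = 1"
proof -
  interpret cring "germ_ring m" by (rule conv_ring_cring)
  have "mvar 0 ^ r * (1 + mvar 1) \<in> conv_series {..m}" using m by (intro conv_intros) auto
  moreover have "mcoeff (mvar 0 ^ r * (1 + mvar 1) :: complex mfps) {#} = 0"
    using r by (simp add: mcoeff_mult_empty mcoeff_mvar_power_empty)
  ultimately obtain c where "c \<in> conv_series {..m}" "a * c = 1"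
    unfolding a_def by (rule conv_series_inverse)
  then have "a \<in> Units (germ_ring m)"
    using a_conv by (auto simp: Units_def mult.commute intro!: bexI)
  then show ?thesis
    unfolding b_def using Units_r_inv by simp
qed

lemma log_deriv_a:
  "log_deriv j a = (if j = 0 then - (of_nat r * mvar 0 ^ r * (1 + mvar 1)) else if j = 1 then - (mvar 0 ^ r) else 0)"
proof -
  let ?Z = "replicate_mset r 0 :: nat multiset"
  have a: "a = 1 - mmonom ?Z - mmonom (?Z + {#1#})"
    unfolding a_def mvar_power unfolding mvar_eq_mmonom by (simp add: mmonom_mult distrib_left)
  have Z: "mvar 0 ^ r * (1 + mvar 1) = (mmonom ?Z + mmonom (?Z + {#1#}) :: complex mfps)"
    unfolding mvar_power unfolding mvar_eq_mmonom by (simp add: mmonom_mult distrib_left)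
  consider "j = 0" | "j = 1" | "j > 1" by linarith
  then show ?thesis
  proof cases
    case 1
    have "mvar 0 * mderiv 0 a = - (of_nat r * (mmonom ?Z + mmonom (?Z + {#1#})))"
      unfolding a mderiv_diff mderiv_one right_diff_distrib mvar_mderiv_mmonom
      by (simp add: algebra_simps)
    then show ?thesis using 1 Z by (simp add: log_deriv_def mult.assoc)
  next
    case 2
    then show ?thesis
      by (simp add: log_deriv_def a mderiv_diff mderiv_one mderiv_mmonom mvar_power)
  next
    case 3
    then show ?thesis
      by (simp add: log_deriv_def a mderiv_diff mderiv_one mderiv_mmonom)
  qed
qed

lemma log_deriv_f:
  assumes "i < m"
  shows "log_deriv j (f (Suc i)) = (if j = Suc i then 1 - of_nat (d (Suc i)) * mvar (Suc i) ^ (d (Suc i) - 1)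
    else if j = i then - (if i = 0 then mvar 0 else 1) else 0)"
  using assms
  by (auto simp: log_deriv_def f_Suc mderiv_diff mderiv_mvar mderiv_mvar_power simp del: power_Suc)

definition H :: "complex mfps mat" where "H = 1\<^sub>m (m + 1) - log_jacobian m f"

lemma H_carrier: "H \<in> carrier_mat (Suc m) (Suc m)"
  unfolding H_def log_jacobian_def Let_def Suc_eq_plus1 by (intro minus_carrier_mat mat_carrier)

lemma H_top: "j \<le> m \<Longrightarrow> H $$ (0, j) =
    (if j = 0 then of_nat r * mvar 0 ^ r * (1 + mvar 1) * b else if j = 1 then mvar 0 ^ r * b else 0)"
  by (simp add: H_def log_jacobian_def Let_def normal_factor_eq log_deriv_a flip: b_def)

lemma H_Suc: "i < m \<Longrightarrow> j \<le> m \<Longrightarrow> H $$ (Suc i, j) =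
    (if j = Suc i then of_nat (d (Suc i)) * mvar (Suc i) ^ (d (Suc i) - 1)
     else if j = i then (if i = 0 then mvar 0 else 1) else 0)"
  by (simp add: H_def log_jacobian_def Let_def log_deriv_f)

text \<open>The entry \<open>H $$ (1, 0)\<close> is \<open>mvar 0\<close>, because dz is z times the
  frame element dz/z. With \<open>mvar 0 ^ r * b\<close> from row 0, the off-diagonal contribution
  is divisible by \<open>mvar 0 ^ (r + 1)\<close> and goes into \<open>w\<close>.\<close>

lemma det_H:
  obtains w where "det H = of_nat (r * (\<Prod>i<m. d (Suc i))) * b * (1 + mvar 1) * top_product + mvar 0 ^ (r + 1) * w"
proof -
  obtain n where n: "m = Suc n" using m by (cases m) auto
  have "det H = H $$ (0, 0) * (\<Prod>i<Suc n. H $$ (Suc i, Suc i))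
    - H $$ (0, 1) * H $$ (1, 0) * (\<Prod>i<n. H $$ (i + 2, i + 2))"
  proof (rule det_lower_bidiagonal_corner)
    show "H \<in> carrier_mat (Suc (Suc n)) (Suc (Suc n))" using H_carrier unfolding n .
    show "H $$ (i, j) = 0" if "0 < i" "i < j" "j < Suc (Suc n)" for i j
      using that H_Suc[of "i - 1" j] unfolding n by (cases i) auto
    show "H $$ (0, j) = 0" if "1 < j" "j < Suc (Suc n)" for j
      using that H_top[of j] unfolding n by auto
    show "H $$ (i, 0) = 0" if "1 < i" "i < Suc (Suc n)" for i
      using that H_Suc[of "i - 1" 0] unfolding n by (cases i) auto
  qed
  also have "(\<Prod>i<Suc n. H $$ (Suc i, Suc i)) = (\<Prod>i<m. of_nat (d (Suc i)) * mvar (Suc i) ^ (d (Suc i) - 1))"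
    unfolding n[symmetric] by (rule prod.cong) (simp_all add: H_Suc)
  also have "\<dots> = of_nat (\<Prod>i<m. d (Suc i)) * (\<Prod>i<m. mvar (Suc i) ^ (d (Suc i) - 1))"
    by (simp add: prod.distrib)
  also have "H $$ (0, 0) = of_nat r * mvar 0 ^ r * (1 + mvar 1) * b" by (simp add: H_top)
  also have "H $$ (0, 1) = mvar 0 ^ r * b" using m by (simp add: H_top)
  also have "H $$ (1, 0) = mvar 0" using H_Suc[of 0 0] m by simp
  finally show ?thesis
    by (intro that[of "- b * (\<Prod>i<n. H $$ (i + 2, i + 2))"]) (simp add: top_product_def algebra_simps)
qed

lemma log_index: "log_de_rham_index m f = of_nat (r * (\<Prod>j=1..m. d j))"
proof -
  let ?P = "\<Prod>i<m. T i" and ?D = "\<Prod>i<m. d (Suc i)" and ?K = "box_top (Suc m) k"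
  obtain w where w: "det H = of_nat (r * ?D) * b * (1 + mvar 1) * top_product + mvar 0 ^ (r + 1) * w"
    by (rule det_H)
  from residue_matrix obtain A u where A: "A \<in> carrier_mat (Suc m) (Suc m)"
    and entries: "\<forall>i\<le>m. \<forall>j\<le>m. A $$ (i, j) \<in> conv_series {..m}"
    and rows: "\<forall>i\<le>m. (\<Sum>j<Suc m. A $$ (i, j) * (mvar j - f j)) = mvar i ^ (k i + 1)"
    and u: "(1 + mvar 1) * u = 1" and det: "det A = u * ?P"
    by (elim exE conjE) (rule that)
  have "log_de_rham_index m f = mcoeff (det A * det H) ?K"
    unfolding log_de_rham_index_def H_def[symmetric]
    by (rule grothendieck_residue_eqI[OF A]) (use entries rows in auto)
  also have "det A * det H
      = ((1 + mvar 1) * u) * (of_nat (r * ?D) * (?P * top_product) * b) + u * ?P * w * mvar 0 ^ (r + 1)"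
    unfolding det w by (simp only: algebra_simps)
  also have "\<dots> = of_nat (r * ?D) * (?P * top_product) * b + u * ?P * w * mvar 0 ^ (r + 1)"
    by (simp only: u mult_1_left)
  \<comment> \<open>Separates the constant term of the unit. Since \<open>top_product\<close>
    already contains \<open>mvar 0 ^ r\<close>, the correction contains
    \<open>mvar 0 ^ (r + r)\<close>, which is killed as \<open>r \<ge> 1\<close>.\<close>
  also have "b = 1 + mvar 0 ^ r * (1 + mvar 1) * b"
    using ab by (simp add: a_def algebra_simps)
  also have "of_nat (r * ?D) * (?P * top_product) * (1 + mvar 0 ^ r * (1 + mvar 1) * b)
      = of_nat (r * ?D) * (?P * top_product)
        + of_nat (r * ?D) * ?P * (\<Prod>i<m. mvar (Suc i) ^ (d (Suc i) - 1)) * (1 + mvar 1) * b * mvar 0 ^ (r + r)"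
    by (simp add: top_product_def power_add algebra_simps)
  also have "mcoeff (\<dots> + u * ?P * w * mvar 0 ^ (r + 1)) ?K = of_nat (r * ?D)"
  proof -
    have "killed {..<Suc m} k (mvar 0 ^ (r + r) :: complex mfps)" "killed {..<Suc m} k (mvar 0 ^ (r + 1) :: complex mfps)"
      using r by (auto simp del: power_Suc simp: k_0 intro!: killed_mvar_power)
    then show ?thesis
      unfolding mcoeff_add mcoeff_of_nat_mult mcoeff_top_product
      by (simp only: mcoeff_box_top_killed[OF killed_mult] add_0_right mult_1_right)
  qed
  also have "?D = (\<Prod>j=1..m. d j)" by (simp add: prod.atLeast1_atMost_eq)
  finally show ?thesis by simp
qed

section \<open>The fixed-point algebra\<close>

text \<open>Descends from \<open>m\<close>, replacing \<open>mvar i\<close> by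
  \<open>- (mvar (Suc i) ^ d (Suc i))\<close>; the constant absorbs the accumulated signs.\<close>

lemma mvar_reduction: "i \<le> m \<Longrightarrow> \<exists>c e. mvar i - mconst c * mvar m ^ e \<in> I"
proof (induction rule: inc_induct)
  case base
  show ?case using conv_ideal_zero[OF I_ideal] by (intro exI[of _ 1]) simp
next
  case (step i)
  let ?x = "mvar (Suc i) ^ d (Suc i)"
  from step.IH obtain c e where "mvar (Suc i) - mconst c * mvar m ^ e \<in> I" by blast
  then have "(mvar (Suc i) - mconst c * mvar m ^ e) * 1 \<in> I" by simp
  then have "(?x - (mconst c * mvar m ^ e) ^ d (Suc i)) * 1 \<in> I"
    by (rule conv_ideal_power_cong[OF I_ideal, rotated 2]) (use step.hyps in \<open>auto intro!: conv_intros\<close>)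
  then have "q (Suc i) - (?x - (mconst c * mvar m ^ e) ^ d (Suc i)) * 1 \<in> I"
    using I_generator[of "Suc i"] step.hyps by (intro conv_ideal_diff[OF I_ideal]) auto
  also have "q (Suc i) - (?x - (mconst c * mvar m ^ e) ^ d (Suc i)) * 1
      = mvar i - mconst (- (c ^ d (Suc i))) * mvar m ^ (e * d (Suc i))"
    using step.hyps by (simp add: q_Suc mconst_uminus mconst_power power_mult_distrib power_mult)
  finally show ?case by blast
qed

lemma mmonom_reduction:
  assumes "set_mset A \<subseteq> {..m}"
  shows "\<exists>c e. mmonom A - mconst c * mvar m ^ e \<in> I"
  using assms
proof (induction A)
  case empty
  show ?case
    using conv_ideal_zero[OF I_ideal] by (intro exI[of _ 1] exI[of _ 0]) (simp flip: one_eq_mmonom)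
next
  case (add i A)
  then have im: "i \<le> m" and Am: "set_mset A \<subseteq> {..m}" by auto
  from add.IH[OF Am] obtain c e where c: "mmonom A - mconst c * mvar m ^ e \<in> I" by blast
  from mvar_reduction[OF im] obtain c' e' where c': "mvar i - mconst c' * mvar m ^ e' \<in> I" by blast
  have "mconst c' * mvar m ^ e' * (mmonom A - mconst c * mvar m ^ e)
      + mmonom A * (mvar i - mconst c' * mvar m ^ e') \<in> I"
    using c c' Am by (intro conv_ideal_add[OF I_ideal] conv_ideal_mult[OF I_ideal] conv_intros) auto
  also have "mconst c' * mvar m ^ e' * (mmonom A - mconst c * mvar m ^ e)
      + mmonom A * (mvar i - mconst c' * mvar m ^ e')
      = mmonom (add_mset i A) - mconst (c * c') * mvar m ^ (e + e')"
    by (simp add: mconst_mult power_add algebra_simps mvar_eq_mmonom mmonom_mult)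
  finally show ?case by blast
qed

lemma mmonom_reduction_truncated:
  assumes "set_mset A \<subseteq> {..m}"
  shows "\<exists>c. mmonom A - (\<Sum>e<N m. mconst (c e) * mvar m ^ e) \<in> I"
proof -
  obtain c e where c: "mmonom A - mconst c * mvar m ^ e \<in> I"
    using mmonom_reduction[OF assms] by blast
  show ?thesis
  proof (cases "e < N m")
    case True
    have "(\<Sum>e'<N m. mconst (if e' = e then c else 0) * mvar m ^ e') = mconst c * mvar m ^ e"
      using True by (simp add: if_distrib[of mconst] if_distrib[of "\<lambda>c. c * _"] cong: if_cong)
    with c show ?thesis by (intro exI[of _ "\<lambda>e'. if e' = e then c else 0"]) simp
  next
    case False
    then have "mconst c * mvar m ^ e \<in> I"
      by (intro conv_ideal_mult[OF I_ideal] conv_intros) (simp add: mvar_power_in_I_iff)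
    with c have "mmonom A - mconst c * mvar m ^ e + mconst c * mvar m ^ e \<in> I"
      by (rule conv_ideal_add[OF I_ideal])
    then show ?thesis by (intro exI[of _ "\<lambda>_. 0"]) simp
  qed
qed

text \<open>The box comes first, so that only finitely many monomials are rewritten as powers of
  \<open>mvar m\<close> and no convergence of the result is at stake.\<close>

lemma reduction:
  assumes h: "h \<in> conv_series {..m}"
  shows "\<exists>c. h - (\<Sum>e<N m. mconst (c e) * mvar m ^ e) \<in> I"
proof -
  let ?B = "{A. A \<subseteq># box_top (Suc m) k}"
  have B: "set_mset A \<subseteq> {..m}" if "A \<in> ?B" for A
    using set_mset_mono[of A "box_top (Suc m) k"] that count_box_top[of "Suc m" k]
    by (auto simp flip: count_greater_zero_iff split: if_splits)
  then have "\<forall>A\<in>?B. \<exists>c. mmonom A - (\<Sum>e<N m. mconst (c e) * mvar m ^ e) \<in> I"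
    using mmonom_reduction_truncated by blast
  then obtain c where c: "\<And>A. A \<in> ?B \<Longrightarrow> mmonom A - (\<Sum>e<N m. mconst (c A e) * mvar m ^ e) \<in> I"
    by metis
  let ?c = "\<lambda>e. \<Sum>A\<in>?B. mcoeff h A * c A e"
  have mconst_sum: "mconst (sum x S) = (\<Sum>y\<in>S. mconst (x y))" for x :: "nat multiset \<Rightarrow> complex" and S
    by (induction S rule: infinite_finite_induct) (simp_all add: mconst_add)
  have "h - (\<Sum>A\<in>?B. mconst (mcoeff h A) * mmonom A) \<in> I"
    using I_ideal mvar_power_in_I h unfolding lessThan_Suc_atMost[symmetric]
    by (intro box_reduction) (auto simp: N_eq_k simp del: power_Suc)
  moreover have "(\<Sum>A\<in>?B. mconst (mcoeff h A) * (mmonom A - (\<Sum>e<N m. mconst (c A e) * mvar m ^ e))) \<in> I"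
    by (intro conv_ideal_sum[OF I_ideal] conv_ideal_mult[OF I_ideal] conv_intros c)
  ultimately have "h - (\<Sum>A\<in>?B. mconst (mcoeff h A) * mmonom A)
      + (\<Sum>A\<in>?B. mconst (mcoeff h A) * (mmonom A - (\<Sum>e<N m. mconst (c A e) * mvar m ^ e))) \<in> I"
    by (rule conv_ideal_add[OF I_ideal])
  also have "(\<Sum>A\<in>?B. mconst (mcoeff h A) * (mmonom A - (\<Sum>e<N m. mconst (c A e) * mvar m ^ e)))
      = (\<Sum>A\<in>?B. mconst (mcoeff h A) * mmonom A)
        - (\<Sum>A\<in>?B. \<Sum>e<N m. mconst (mcoeff h A * c A e) * mvar m ^ e)"
    by (simp add: right_diff_distrib sum_subtractf sum_distrib_left mconst_mult mult.assoc)
  also have "(\<Sum>A\<in>?B. \<Sum>e<N m. mconst (mcoeff h A * c A e) * mvar m ^ e)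
      = (\<Sum>e<N m. mconst (?c e) * mvar m ^ e)"
    by (subst sum.swap) (simp add: mconst_sum sum_distrib_right)
  finally have "h - (\<Sum>e<N m. mconst (?c e) * mvar m ^ e) \<in> I" by simp
  then show ?thesis by (intro exI[of _ ?c])
qed

lemma coset_hom: "(+>\<^bsub>germ_ring m\<^esub>) I \<in> Ring.ring_hom (germ_ring m) (germ_ring m Quot I)"
  by (rule ideal.rcos_ring_hom[OF I_ideal])

lemma coset_eq_zero_iff:
  "x \<in> conv_series {..m} \<Longrightarrow> I +>\<^bsub>germ_ring m\<^esub> x = \<zero>\<^bsub>germ_ring m Quot I\<^esub> \<longleftrightarrow> x \<in> I"
  using conv_coset_eq_iff[OF I_ideal, of x 0] zero_in_conv
    Ring.ring_hom_zero[OF coset_hom conv_ring_ring ideal.quotient_is_ring[OF I_ideal]] by simp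

text \<open>The \<open>N m\<close> powers of \<open>mvar m\<close> span the quotient, and the
  nilpotency order of its class is also \<open>N m\<close>.\<close>

lemma length_eq: "ring_length (germ_ring m Quot I) = enat (N m)"
proof (rule antisym)
  let ?T = "(\<lambda>e. mvar m ^ e :: complex mfps) ` {..<N m}"
  have inj: "inj_on (\<lambda>e. mvar m ^ e :: complex mfps) {..<N m}"
    using inj_mvar_power by (rule inj_on_subset) simp
  have "ring_length (germ_ring m Quot I) \<le> enat (card ?T)"
  proof (rule ring_length_quot_le_card[OF I_ideal])
    show "?T \<subseteq> conv_series {..m}" by (auto intro!: conv_intros)
    fix h assume "h \<in> conv_series {..m}"
    then obtain c where "h - (\<Sum>e<N m. mconst (c e) * mvar m ^ e) \<in> I" using reduction by blast
    then show "\<exists>c. h - (\<Sum>t\<in>?T. mconst (c t) * t) \<in> I"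
      using inj by (intro exI[of _ "\<lambda>t. c (inv_into {..<N m} (\<lambda>e. mvar m ^ e) t)"]) (simp add: sum.reindex)
  qed simp
  then show "ring_length (germ_ring m Quot I) \<le> enat (N m)" using inj by (simp add: card_image)
next
  let ?A = "germ_ring m Quot I" and ?t = "I +>\<^bsub>germ_ring m\<^esub> mvar m"
  interpret A: cring ?A by (rule ideal.quotient_is_cring[OF I_ideal conv_ring_cring])
  have pow: "?t [^]\<^bsub>?A\<^esub> (e :: nat) = I +>\<^bsub>germ_ring m\<^esub> mvar m ^ e" for e
  proof (induction e)
    case 0
    show ?case using Ring.ring_hom_one[OF coset_hom] by simp
  next
    case (Suc e)
    then show ?case
      using Ring.ring_hom_mult[OF coset_hom, of "mvar m ^ e" "mvar m"] mvar_conv[of m]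
      by (simp add: power_in_conv mult.commute)
  qed
  show "enat (N m) \<le> ring_length ?A"
  proof (rule ring_length_ge_nilpotent[OF A.is_cring])
    show "?t \<in> carrier ?A" using Ring.ring_hom_closed[OF coset_hom] mvar_conv[of m] by simp
    show "?t [^]\<^bsub>?A\<^esub> N m = \<zero>\<^bsub>?A\<^esub>" "?t [^]\<^bsub>?A\<^esub> (N m - 1) \<noteq> \<zero>\<^bsub>?A\<^esub>"
      using N_pos[of m] unfolding pow
      by (simp_all add: coset_eq_zero_iff power_in_conv mvar_conv mvar_power_in_I_iff)
  qed
qed

definition J where "J = Idl\<^bsub>conv_ring {m}\<^esub> {mvar m ^ N m}"

lemma J_eq: "J = {c * mvar m ^ N m |c. c \<in> conv_series {m}}"
proof -
  have "J = Idl\<^bsub>conv_ring {m}\<^esub> ((\<lambda>_. mvar m ^ N m) ` {..<Suc 0})" by (simp add: J_def lessThan_Suc)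
  also have "\<dots> = {\<Sum>j<Suc 0. c j * mvar m ^ N m |c. \<forall>j<Suc 0. c j \<in> conv_series {m}}"
    by (rule genideal_conv_ring) (simp add: conv_intros)
  also have "\<dots> = {c * mvar m ^ N m |c. c \<in> conv_series {m}}" by (auto intro: exI[of _ "\<lambda>_. _"])
  finally show ?thesis .
qed

lemma conv_sub: "g \<in> conv_series {m} \<Longrightarrow> g \<in> conv_series {..m}"
  using conv_series_mono[of "{m}" "{..m}"] by auto

text \<open>The lowest coefficient of \<open>g\<close> must vanish, because otherwise \<open>g\<close> times a power of
  \<open>y\<^sub>m\<close> would put \<open>y\<^sub>m ^ (N m - 1)\<close> into \<open>I\<close>.\<close>

lemma conv_inter_I_dvd:
  assumes g: "g \<in> conv_series {m}" "g \<in> I" and "e \<le> N m"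
  shows "\<exists>h\<in>conv_series {m}. g = mvar m ^ e * h"
  using assms(3)
proof (induction e)
  case 0
  show ?case using g(1) by (intro bexI[of _ g]) simp_all
next
  case (Suc e)
  then obtain h where h: "h \<in> conv_series {m}" "g = mvar m ^ e * h" by auto
  define c where "c = mcoeff h {#}"
  obtain h' where h': "h' \<in> conv_series {m}" "h - mconst c = mmonom {#m#} * h'"
  proof (rule conv_series_mmonom_dvd)
    show diff: "h - mconst c \<in> conv_series {m}" using h(1) by (intro conv_intros)
    show "{#m#} \<subseteq># A" if A: "mcoeff (h - mconst c) A \<noteq> 0" for A
    proof -
      have "A \<noteq> {#}" using A by (auto simp: c_def mcoeff_mconst)
      moreover have "set_mset A \<subseteq> {m}"
        using diff A unfolding conv_series_iff supported_def by blast
      ultimately show ?thesis by (metis mset_subset_eq_single set_mset_eq_empty_iff subset_singletonD insertI1)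
    qed
  qed
  then have h_eq: "h = mconst c + mvar m * h'" by (simp add: mvar_eq_mmonom algebra_simps)
  have "c = 0"
  proof (rule ccontr)
    assume "c \<noteq> 0"
    have e: "N m - 1 - e + e = N m - 1" "N m - 1 - e + Suc e = N m" using Suc.prems by auto
    have gh: "g = mconst c * mvar m ^ e + h' * mvar m ^ Suc e"
      unfolding h(2) h_eq by (simp add: algebra_simps)
    have "mvar m ^ (N m - 1 - e) * g = mconst c * mvar m ^ (N m - 1 - e + e) + h' * mvar m ^ (N m - 1 - e + Suc e)"
      unfolding gh power_add by (simp only: algebra_simps)
    then have eq: "mconst (inverse c) * (mvar m ^ (N m - 1 - e) * g - h' * mvar m ^ N m)
        = mconst (inverse c * c) * mvar m ^ (N m - 1)"
      unfolding e by (simp add: mconst_mult mult.assoc)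
    have "mconst (inverse c) * (mvar m ^ (N m - 1 - e) * g - h' * mvar m ^ N m) \<in> I"
      using g(2) h'(1) mvar_power_in_I[of m] mvar_conv[of m]
      by (intro conv_ideal_mult[OF I_ideal] conv_ideal_diff[OF I_ideal])
        (auto intro: conv_intros conv_sub)
    then have "mvar m ^ (N m - 1) \<in> I" using \<open>c \<noteq> 0\<close> unfolding eq by simp
    then show False using Suc.prems by (simp add: mvar_power_in_I_iff)
  qed
  then have "g = mvar m ^ Suc e * h'" unfolding h(2) h_eq by (simp add: mult_ac)
  then show ?case using h'(1) by blast
qed

text \<open>Identifies the kernel of the map from the one-variable ring to the fixed-point
  algebra.\<close>

lemma conv_inter_I: "{g \<in> conv_series {m}. g \<in> I} = J"
proof
  show "{g \<in> conv_series {m}. g \<in> I} \<subseteq> J"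
    using conv_inter_I_dvd[OF _ _ order_refl] unfolding J_eq by (force simp: mult.commute)
  show "J \<subseteq> {g \<in> conv_series {m}. g \<in> I}"
    unfolding J_eq using mvar_power_in_I[of m]
    by (auto intro!: conv_intros conv_ideal_mult[OF I_ideal] conv_sub)
qed

text \<open>The inclusion of the one-variable ring followed by the quotient map is onto by
  \<open>reduction\<close>. The isomorphism theorem gives a map into the fixed-point algebra,
  inverted at the end; the formula on cosets makes it one of complex algebras matching the classes
  of \<open>mvar m\<close>.\<close>

lemma fixed_algebra_iso:
  "\<exists>\<phi>\<in>ring_iso (germ_ring m Quot I) (conv_ring {m} Quot J).
    \<forall>g\<in>conv_series {m}. \<phi> (I +>\<^bsub>germ_ring m\<^esub> g) = J +>\<^bsub>conv_ring {m}\<^esub> g"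
proof -
  let ?S = "conv_ring {m}" and ?A = "germ_ring m Quot I"
  define \<psi> where "\<psi> = (\<lambda>g. I +>\<^bsub>germ_ring m\<^esub> g)"
  interpret S: cring ?S by (rule conv_ring_cring)
  have A: "ring ?A" by (rule ideal.quotient_is_ring[OF I_ideal])
  have hom: "\<psi> \<in> Ring.ring_hom ?S ?A"
  proof (rule ring_hom_memI)
    note rules = Ring.ring_hom_closed[OF coset_hom] Ring.ring_hom_mult[OF coset_hom]
      Ring.ring_hom_add[OF coset_hom] Ring.ring_hom_one[OF coset_hom]
    show "\<psi> x \<in> carrier ?A" if "x \<in> carrier ?S" for x
      using rules(1)[of x] that conv_sub by (simp add: \<psi>_def)
    show "\<psi> (x \<otimes>\<^bsub>?S\<^esub> y) = \<psi> x \<otimes>\<^bsub>?A\<^esub> \<psi> y" "\<psi> (x \<oplus>\<^bsub>?S\<^esub> y) = \<psi> x \<oplus>\<^bsub>?A\<^esub> \<psi> y"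
      if "x \<in> carrier ?S" "y \<in> carrier ?S" for x y
      using rules(2,3)[of x y] that conv_sub by (simp_all add: \<psi>_def)
    show "\<psi> \<one>\<^bsub>?S\<^esub> = \<one>\<^bsub>?A\<^esub>" using rules(4) by (simp add: \<psi>_def)
  qed
  interpret \<psi>: ring_hom_ring ?S ?A \<psi>
    by (rule ring_hom_ringI2[OF S.ring_axioms A hom])
  have kernel: "a_kernel ?S ?A \<psi> = J"
    unfolding a_kernel_def' conv_inter_I[symmetric]
    using coset_eq_zero_iff conv_sub by (auto simp: \<psi>_def)
  have surj: "\<psi> ` carrier ?S = carrier ?A"
  proof
    show "\<psi> ` carrier ?S \<subseteq> carrier ?A" using \<psi>.hom_closed by blast
    show "carrier ?A \<subseteq> \<psi> ` carrier ?S"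
    proof
      fix X assume "X \<in> carrier ?A"
      then obtain h where h: "h \<in> conv_series {..m}" "X = \<psi> h"
        by (auto simp: FactRing_def A_RCOSETS_def' \<psi>_def)
      obtain c where c: "h - (\<Sum>e<N m. mconst (c e) * mvar m ^ e) \<in> I"
        using reduction[OF h(1)] by blast
      let ?g = "\<Sum>e<N m. mconst (c e) * mvar m ^ e"
      have g: "?g \<in> conv_series {m}" by (auto intro!: conv_intros)
      then have "X = \<psi> ?g"
        using conv_coset_eq_iff[OF I_ideal h(1) conv_sub[OF g]] c h(2) by (simp add: \<psi>_def)
      with g show "X \<in> \<psi> ` carrier ?S" by simp
    qed
  qed
  define \<theta> where "\<theta> = (\<lambda>X. the_elem (\<psi> ` X))"
  have \<theta>: "\<theta> \<in> ring_iso (?S Quot J) ?A"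
    using \<psi>.FactRing_iso_set[OF surj] unfolding kernel \<theta>_def .
  have J: "ideal J ?S" using \<psi>.kernel_is_ideal unfolding kernel .
  show ?thesis
  proof
    show "inv_into (carrier (?S Quot J)) \<theta> \<in> ring_iso ?A (?S Quot J)"
      by (rule ring_iso_set_sym[OF ideal.quotient_is_ring[OF J] \<theta>])
    show "\<forall>g\<in>conv_series {m}. inv_into (carrier (?S Quot J)) \<theta> (I +>\<^bsub>germ_ring m\<^esub> g) = J +>\<^bsub>?S\<^esub> g"
    proof
      fix g assume g: "g \<in> conv_series {m}"
      have "\<theta> (J +>\<^bsub>?S\<^esub> g) = I +>\<^bsub>germ_ring m\<^esub> g"
        using \<psi>.the_elem_simp[of g] g unfolding kernel \<theta>_def by (simp add: \<psi>_def)
      moreover have "J +>\<^bsub>?S\<^esub> g \<in> carrier (?S Quot J)"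
        using g by (auto simp: FactRing_def A_RCOSETS_def')
      moreover have "inj_on \<theta> (carrier (?S Quot J))"
        using \<theta> by (simp add: ring_iso_def bij_betw_def)
      ultimately show "inv_into (carrier (?S Quot J)) \<theta> (I +>\<^bsub>germ_ring m\<^esub> g) = J +>\<^bsub>?S\<^esub> g"
        by (metis inv_into_f_f)
    qed
  qed
qed

section \<open>Normal initial forms and admissibility\<close>

lemma normal_initial_0: "normal_order (q 0) = r + 1" "normal_initial (q 0) = mvar 0 ^ (r + 1)"
  unfolding q_0 mvar_power normal_mmonom by simp_all

text \<open>The term \<open>mvar 0\<close> has normal order one and drops out; this is the only
  generator changed by passing to initial forms.\<close>

lemma normal_initial_1: "normal_initial (q 1) = mvar 1 ^ d 1"
proof -
  have neq: "replicate_mset (d 1) 1 \<noteq> {#0 :: nat#}"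
    by (metis count_replicate_mset count_single zero_neq_one)
  have "normal_initial (q 1) = restrict_series (\<lambda>A. count A 0 = 0) (q 1)"
    by (rule normal_initial_order_0[of _ "replicate_mset (d 1) 1"])
      (use neq in \<open>simp_all add: q_1 mvar_power mvar_eq_mmonom[of 0] mcoeff_mmonom del: One_nat_def\<close>)
  also have "\<dots> = mvar 1 ^ d 1"
    by (rule mfps_eqI) (use neq in \<open>auto simp: q_1 mvar_power mvar_eq_mmonom[of 0] mcoeff_mmonom simp del: One_nat_def\<close>)
  finally show ?thesis .
qed

lemma normal_initial_Suc:
  assumes "0 < j" "j < m"
  shows "normal_initial (q (Suc j)) = q (Suc j)"
proof -
  let ?C = "replicate_mset (d (Suc j)) (Suc j)"
  have coeff: "mcoeff (q (Suc j)) A = (if A = ?C then 1 else 0) + (if A = {#j#} then 1 else 0)" for A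
    unfolding q_Suc[OF assms(2)] mvar_power mvar_eq_mmonom[of j] mcoeff_add mcoeff_mmonom ..
  have "normal_initial (q (Suc j)) = restrict_series (\<lambda>A. count A 0 = 0) (q (Suc j))"
    by (rule normal_initial_order_0[of _ ?C]) (auto simp: coeff)
  also have "\<dots> = q (Suc j)"
    by (rule mfps_eqI) (use assms in \<open>auto simp: coeff\<close>)
  finally show ?thesis .
qed

lemma admissible: "normally_admissible m f q"
  unfolding normally_admissible_def
proof (intro conjI)
  show "regular_sequence (germ_ring m) m q" by (rule regular)
  show "Idl\<^bsub>germ_ring m\<^esub> (q ` {..m}) = fixed_ideal m f"
    by (simp add: fixed_ideal_eq I_def lessThan_Suc_atMost)
  have "normal_order (q 0) \<le> (\<Sum>j\<le>m. normal_order (q j))"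
    by (rule member_le_sum) simp_all
  then show "1 \<le> (\<Sum>j\<le>m. normal_order (q j))" by (simp add: normal_initial_0)
  let ?p = "\<lambda>j. normal_initial (q j)"
  let ?J = "Idl\<^bsub>germ_ring m\<^esub> (?p ` {..<Suc m})"
  have p: "?p j \<in> conv_series {..m}" if "j < Suc m" for j
    unfolding normal_initial_def restrict_series_def[symmetric]
    using q_conv that by (intro restrict_in_conv) simp
  have J: "ideal ?J (germ_ring m)" by (rule genideal_conv_ring_ideal) (rule p)
  have gen: "?p j \<in> ?J" if "j < Suc m" for j by (rule genideal_conv_ring_generator[OF p that])
  \<comment> \<open>The initial forms contain pure powers of the first two variables; from there on
    the unchanged equations pass nilpotency up the tower.\<close>
  have "\<exists>e. mvar i ^ (e + 1) \<in> ?J" if "i \<le> m" for i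
    using that
  proof (induction i)
    case 0
    show ?case using gen[of 0] normal_initial_0(2) by auto
  next
    case (Suc i)
    show ?case
    proof (cases "i = 0")
      case True
      then have "mvar (Suc i) ^ (d 1 - 1 + 1) \<in> ?J"
        using gen[of 1] normal_initial_1 d[of 1] m by simp
      then show ?thesis ..
    next
      case False
      let ?x = "mvar (Suc i) ^ d (Suc i)" and ?y = "mvar i"
      from Suc obtain e where e: "mvar i ^ (e + 1) \<in> ?J" by auto
      have "(?x - - ?y) * 1 \<in> ?J"
        using gen[of "Suc i"] normal_initial_Suc[of i] q_Suc[of i] False Suc.prems by simp
      then have "(?x ^ (e + 1) - (- ?y) ^ (e + 1)) * 1 \<in> ?J"
        by (rule conv_ideal_power_cong[OF J, rotated 2]) (use Suc.prems in \<open>auto intro!: conv_intros\<close>)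
      moreover have "(- 1) ^ (e + 1) * ?y ^ (e + 1) \<in> ?J"
        by (intro conv_ideal_mult[OF J e] conv_intros)
      ultimately have "(?x ^ (e + 1) - (- ?y) ^ (e + 1)) * 1 + (- 1) ^ (e + 1) * ?y ^ (e + 1) \<in> ?J"
        by (rule conv_ideal_add[OF J])
      also have "(?x ^ (e + 1) - (- ?y) ^ (e + 1)) * 1 + (- 1) ^ (e + 1) * ?y ^ (e + 1)
          = mvar (Suc i) ^ (d (Suc i) * (e + 1))"
        unfolding power_minus[of ?y] power_mult by simp
      also have "d (Suc i) * (e + 1) = d (Suc i) * (e + 1) - 1 + 1"
        using d[of "Suc i"] Suc.prems by simp
      finally show ?thesis ..
    qed
  qed
  then obtain l where "\<And>i. i < Suc m \<Longrightarrow> mvar i ^ (l i + 1) \<in> ?J" by (metis less_Suc_eq_le)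
  then have "ring_length (conv_ring {..<Suc m} Quot ?J) < \<infinity>"
    using J unfolding lessThan_Suc_atMost[symmetric] by (intro ring_length_quot_finite) auto
  then show "ring_length (germ_ring m Quot Idl\<^bsub>germ_ring m\<^esub> (?p ` {..m})) < \<infinity>"
    by (simp add: lessThan_Suc_atMost)
qed

section \<open>The fixed point is isolated\<close>

lemma meval_f_0: "meval (f 0) x = x 0 - x 0 ^ (r + 1) * (1 + x 1)"
proof -
  let ?Z = "replicate_mset (r + 1) 0 :: nat multiset"
  have f: "f 0 = mmonom {#0#} - (mmonom ?Z + mmonom (?Z + {#1#}))"
    unfolding f_0 mvar_power by (simp add: mvar_eq_mmonom mmonom_mult distrib_left)
  show ?thesis
    unfolding f by (simp add: meval_diff meval_add finsupp_add finsupp_mmonom meval_mmonom algebra_simps)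
qed

lemma meval_f_Suc: "j < m \<Longrightarrow> meval (f (Suc j)) x = x (Suc j) - x (Suc j) ^ d (Suc j) - x j"
  unfolding f_Suc mvar_power unfolding mvar_eq_mmonom
  by (simp add: meval_diff finsupp_diff finsupp_mmonom meval_mmonom)

lemma isolated: "isolated_fixed_point m f"
  unfolding isolated_fixed_point_def
\<comment> \<open>Radius 1 keeps \<open>x 1\<close> away from -1, so the first equation forces
  \<open>x 0 = 0\<close>; the others then vanish one after another.\<close>
proof (intro conjI allI impI exI[of _ "1::real"])
  fix i assume i: "i \<le> m"
  show "f i \<in> carrier (germ_ring m)" using f_conv[OF i] by simp
  show "meval (f i) (\<lambda>_. 0) = 0"
    using i d[of i] by (cases i) (simp_all add: meval_f_0 meval_f_Suc)
next
  fix x i assume x: "(\<forall>i\<le>m. norm (x i) < 1) \<and> (\<forall>i\<le>m. meval (f i) x = x i)" and "i \<le> m"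
  show "x i = 0" using \<open>i \<le> m\<close>
  proof (induction i)
    case 0
    have "norm (x 1) < 1" using x m by blast
    then have "1 + x 1 \<noteq> 0" by (metis add_eq_0_iff norm_minus_cancel norm_one less_irrefl)
    moreover have "meval (f 0) x = x 0" using x by blast
    ultimately show ?case by (auto simp: meval_f_0)
  next
    case (Suc i)
    then have "meval (f (Suc i)) x = x (Suc i)" using x by blast
    with Suc show ?case by (simp add: meval_f_Suc)
  qed
qed simp

end

theorem proposition9p4:
  fixes m r M :: nat
    and d :: "nat \<Rightarrow> nat"
    and f q :: "nat \<Rightarrow> complex mfps"
  assumes "m \<ge> 1" and "r \<ge> 1"
    and "\<And>j. 1 \<le> j \<Longrightarrow> j \<le> m \<Longrightarrow> d j \<ge> 2"
    and "f 0 = mvar 0 - mvar 0 ^ (r + 1) * (1 + mvar 1)"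
    and "f 1 = mvar 1 - mvar 1 ^ d 1 - mvar 0"
    and "\<And>j. 2 \<le> j \<Longrightarrow> j \<le> m \<Longrightarrow> f j = mvar j - mvar j ^ d j - mvar (j - 1)"
    and "M = (\<Prod>j=1..m. d j)"
    and "q 0 = mvar 0 ^ (r + 1)"
    and "q 1 = mvar 1 ^ d 1 + mvar 0"
    and "\<And>j. 2 \<le> j \<Longrightarrow> j \<le> m \<Longrightarrow> q j = mvar j ^ d j + mvar (j - 1)"
  shows
    "isolated_fixed_point m f \<and> normally_resonant m f \<and>
     (let I = fixed_ideal m f;
          S = conv_ring {m};
          J = Idl\<^bsub>S\<^esub> {mvar m ^ ((r + 1) * M)}
      in \<exists>\<phi> \<in> ring_iso (fixed_algebra m f) (S Quot J).
           (\<forall>c. \<phi> (I +>\<^bsub>germ_ring m\<^esub> mconst c) = J +>\<^bsub>S\<^esub> mconst c) \<and>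
           \<phi> (I +>\<^bsub>germ_ring m\<^esub> mvar m) = J +>\<^bsub>S\<^esub> mvar m) \<and>
     ring_length (fixed_algebra m f) = enat ((r + 1) * M) \<and>
     1 + mvar 1 \<in> Units (germ_ring m) \<and>
     mvar 0 - f 0 = (1 + mvar 1) * q 0 \<and>
     (\<forall>j\<in>{1..m}. mvar j - f j = q j) \<and>
     normally_admissible m f q \<and>
     log_de_rham_index m f = of_nat (r * M)"
proof -
  interpret tower m r d f q by unfold_locales (rule assms; assumption)+
  have N: "(r + 1) * M = N m" by (simp add: N_def assms(7))
  have alg: "fixed_algebra m f = germ_ring m Quot I"
    by (simp add: fixed_algebra_def fixed_ideal_eq)
  obtain \<phi> where \<phi>: "\<phi> \<in> ring_iso (germ_ring m Quot I) (conv_ring {m} Quot J)"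
    "\<And>g. g \<in> conv_series {m} \<Longrightarrow> \<phi> (I +>\<^bsub>germ_ring m\<^esub> g) = J +>\<^bsub>conv_ring {m}\<^esub> g"
    using fixed_algebra_iso by blast
  show ?thesis
    unfolding Let_def N fixed_ideal_eq alg J_def[symmetric]
  proof (intro conjI ballI)
    show "\<exists>\<phi>\<in>ring_iso (germ_ring m Quot I) (conv_ring {m} Quot J).
        (\<forall>c. \<phi> (I +>\<^bsub>germ_ring m\<^esub> mconst c) = J +>\<^bsub>conv_ring {m}\<^esub> mconst c) \<and>
        \<phi> (I +>\<^bsub>germ_ring m\<^esub> mvar m) = J +>\<^bsub>conv_ring {m}\<^esub> mvar m"
      using \<phi> by (intro bexI[of _ \<phi>]) (simp_all add: mconst_in_conv mvar_in_conv)
    show "mvar j - f j = q j" if "j \<in> {1..m}" for j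
      using denominator_Suc[of "j - 1"] that by (cases j) simp_all
    show "log_de_rham_index m f = of_nat (r * M)" using log_index assms(7) by simp
  qed (rule isolated resonant length_eq unit_Units denominator_0 admissible)+
qed

end
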